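(* For any $\chi\ge56$, any $L>16\mu>0$ and any first-order decentralized optimization method $\mathcal M$ with initial point $x_0$, there exist a set of $L$-smooth and $\mu$-strongly convex functions $\{f_i\}_{i=1}^m$, a sequence of graphs $\{\mathcal G_k=(\mathcal V,\mathcal E_k)\}_{k=0}^\infty$ with $|\mathcal V|=m$, and a sequence of corresponding gossip matrices $\{W(\mathcal G_k)\}_{k=0}^\infty$ such that for each $k=0,1,\dots$ it holds $\chi(W(\mathcal G_k))=\chi$, and method $\mathcal M$ requires at least $\Omega\bigl(\chi\sqrt{L/\mu}\,\log(1/\varepsilon)\bigr)$ communication rounds to reach accuracy $\varepsilon$, i.e. $\|x_k-x_*\|^2\le\varepsilon\|x_0-x_*\|^2$, where $x_k$ is the output of $\mathcal M$ at step $k$ and $x_*$ is the minimizer of $f=\frac1m\sum_{i=1}^m f_i$.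
   Context: Functions are defined on the Hilbert space $\ell_2$. A function $h$ is $\mu$-strongly convex if $h(y)\ge h(x)+\langle\nabla h(x),y-x\rangle+\frac\mu2\|y-x\|^2$ for all $x,y$, and $L$-smooth if $\|\nabla h(y)-\nabla h(x)\|\le L\|y-x\|$ for all $x,y$. $\Omega$ hides an absolute positive constant (asymptotics for small $\varepsilon$). Graphs are undirected and loop-less. A matrix $W(\mathcal G)\in\mathbb R^{m\times m}$ is a gossip matrix of a graph $\mathcal G=(\mathcal V,\mathcal E)$ with $m$ nodes if (1) $[W(\mathcal G)]_{i,j}=0$ whenever $i\ne j$ and $(i,j)\notin\mathcal E$; (2) $\ker W(\mathcal G)=\{x\in\mathbb R^m:x_1=\dots=x_m\}$. For example, the Laplacian of a connected graph with positive edge weights is a gossip matrix. For a symmetric positive semidefinite gossip matrix $W$, $\chi(W)=\lambda_{\max}(W)/\lambda_{\min}^+(W)$, where $\lambda_{\min}^+$ is the smallest positive eigenvalue. First-order decentralized methods: node $i$ holds $f_i$ and has a local memory $\mathcal H_i(k)$ at each time step $k$, with initial memory $\mathcal H_i(0)=\{x_0\}$. Each step is either a local computation or a communication round; for a time step $k$, $q(k)$ denotes the last communication time. 1. If the nodes perform a local computation at step $k$, then for all $i$ $$\mathcal H_i(k+1)\subseteq\mathrm{span}\bigl(\{x,\nabla f_i(x),\nabla f_i^*(x): x\in\mathcal H_i(k)\}\bigr),$$ where $f^*(y)=\sup_x\{\langle y,x\rangle-f(x)\}$ is the Fenchel dual. 2. If the nodes perform a communication round at step $k$, then for all $i$ $$\mathcal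 H_i(k+1)\subseteq\mathrm{span}\Bigl(\bigcup_{j\in\mathcal N_i^{q(k)}\cup\{i\}}\mathcal H_j(k)\Bigr),$$ where $\mathcal N_i^{q(k)}$ is the set of neighbors of node $i$ in the communication graph at time step $q(k)$, i.e. at the time of the last communication. The output $x_k$ at step $k$ is an element of the local memory $\mathcal H_i(k)$ of some node $i$.
   Formalization: The method's choice between local computation and communication at step k may not depend on graphs or gossip matrices of later steps; a method foreseeing the graphs could wait for a recurring one and beat the bound. *)

theory Defs
  imports
    "HOL-Analysis.Inner_Product"
    "Jordan_Normal_Form.Char_Poly"
    "Jordan_Normal_Form.Matrix_Kernel"
begin

section \<open>The Hilbert space of square-summable real sequences\<close>

typedef ell2 = "{x :: nat \<Rightarrow> real. summable (\<lambda>n. (x n)\<^sup>2)}"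
  morphisms coord Abs_ell2
  by (rule exI[of _ "\<lambda>_. 0"]) simp

setup_lifting type_definition_ell2

lemma summable_coord_mult:
  assumes "summable (\<lambda>n. (x n)\<^sup>2)" "summable (\<lambda>n. (y n)\<^sup>2)"
  shows "summable (\<lambda>n. x n * y n :: real)"
proof (rule summable_comparison_test')
  show "summable (\<lambda>n. (x n)\<^sup>2 + (y n)\<^sup>2)"
    using assms by (rule summable_add)
  show "norm (x n * y n) \<le> (x n)\<^sup>2 + (y n)\<^sup>2" for n
  proof -
    have "2 * (\<bar>x n\<bar> * \<bar>y n\<bar>) \<le> (x n)\<^sup>2 + (y n)\<^sup>2"
      using sum_squares_bound[of "\<bar>x n\<bar>" "\<bar>y n\<bar>"] by (simp add: mult.assoc)
    moreover have "0 \<le> \<bar>x n\<bar> * \<bar>y n\<bar>" by simp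
    ultimately show ?thesis unfolding real_norm_def abs_mult by linarith
  qed
qed

lemma summable_square_add:
  assumes "summable (\<lambda>n. (x n)\<^sup>2)" "summable (\<lambda>n. (y n)\<^sup>2)"
  shows "summable (\<lambda>n. (x n + y n :: real)\<^sup>2)"
proof -
  have "summable (\<lambda>n. (x n)\<^sup>2 + (y n)\<^sup>2 + 2 * (x n * y n))"
    by (intro summable_add summable_mult assms summable_coord_mult)
  then show ?thesis by (simp add: power2_sum mult.assoc)
qed

instantiation ell2 :: real_vector
begin

lift_definition zero_ell2 :: ell2 is "\<lambda>_. 0" by simp

lift_definition plus_ell2 :: "ell2 \<Rightarrow> ell2 \<Rightarrow> ell2" is "\<lambda>x y n. x n + y n"
  by (rule summable_square_add)

lift_definition uminus_ell2 :: "ell2 \<Rightarrow> ell2" is "\<lambda>x n. - x n" by simp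

lift_definition minus_ell2 :: "ell2 \<Rightarrow> ell2 \<Rightarrow> ell2" is "\<lambda>x y n. x n - y n"
  subgoal for x y using summable_square_add[of x "\<lambda>n. - y n"] by simp
  done

lift_definition scaleR_ell2 :: "real \<Rightarrow> ell2 \<Rightarrow> ell2" is "\<lambda>r x n. r * x n"
  by (simp add: power_mult_distrib summable_mult)

instance
  by standard (transfer; simp add: algebra_simps fun_eq_iff)+

end

instantiation ell2 :: real_inner
begin

lift_definition inner_ell2 :: "ell2 \<Rightarrow> ell2 \<Rightarrow> real" is "\<lambda>x y. \<Sum>n. x n * y n" .

definition norm_ell2 :: "ell2 \<Rightarrow> real" where
  "norm_ell2 x = sqrt (inner x x)"

definition sgn_ell2 :: "ell2 \<Rightarrow> ell2" where
  "sgn_ell2 x = inverse (norm x) *\<^sub>R x"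

definition dist_ell2 :: "ell2 \<Rightarrow> ell2 \<Rightarrow> real" where
  "dist_ell2 x y = norm (x - y)"

definition uniformity_ell2 :: "(ell2 \<times> ell2) filter" where
  "uniformity_ell2 = (INF e\<in>{0<..}. principal {(x, y). dist x y < e})"

definition open_ell2 :: "ell2 set \<Rightarrow> bool" where
  "open_ell2 U \<longleftrightarrow> (\<forall>x\<in>U. eventually (\<lambda>(x', y). x' = x \<longrightarrow> y \<in> U) uniformity)"

instance
proof
  fix x y z :: ell2 and r :: real
  show "dist x y = norm (x - y)" by (fact dist_ell2_def)
  show "sgn x = x /\<^sub>R norm x" by (simp add: sgn_ell2_def)
  show "uniformity = (INF e\<in>{0<..}. principal {(x :: ell2, y). dist x y < e})"
    by (fact uniformity_ell2_def)
  show "open U \<longleftrightarrow> (\<forall>x\<in>U. \<forall>\<^sub>F (x', y) in uniformity. x' = x \<longrightarrow> y \<in> U)" for U :: "ell2 set"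
    by (fact open_ell2_def)
  show "inner x y = inner y x"
    by transfer (simp add: mult.commute)
  show "inner (x + y) z = inner x z + inner y z"
    by transfer (simp add: distrib_right suminf_add summable_coord_mult)
  show "inner (r *\<^sub>R x) y = r * inner x y"
    by transfer (simp add: mult.assoc suminf_mult summable_coord_mult)
  show "0 \<le> inner x x"
    by transfer (simp add: suminf_nonneg flip: power2_eq_square)
  show "inner x x = 0 \<longleftrightarrow> x = 0"
    by transfer (simp add: suminf_eq_zero_iff fun_eq_iff flip: power2_eq_square)
  show "norm x = sqrt (inner x x)" by (fact norm_ell2_def)
qed

end

section \<open>Smooth and strongly convex functions\<close>

definition differentiable_fun :: "(ell2 \<Rightarrow> real) \<Rightarrow> bool" where
  "differentiable_fun h \<longleftrightarrow> (\<forall>x. \<exists>D. GDERIV h x :> D)"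

definition gradient :: "(ell2 \<Rightarrow> real) \<Rightarrow> ell2 \<Rightarrow> ell2" where
  "gradient h x = (THE D. GDERIV h x :> D)"

definition strongly_convex :: "real \<Rightarrow> (ell2 \<Rightarrow> real) \<Rightarrow> bool" where
  "strongly_convex \<mu> h \<longleftrightarrow> differentiable_fun h \<and>
     (\<forall>x y. h y \<ge> h x + inner (gradient h x) (y - x) + \<mu> / 2 * (norm (y - x))\<^sup>2)"

definition smooth_fun :: "real \<Rightarrow> (ell2 \<Rightarrow> real) \<Rightarrow> bool" where
  "smooth_fun L h \<longleftrightarrow> differentiable_fun h \<and>
     (\<forall>x y. norm (gradient h y - gradient h x) \<le> L * norm (y - x))"

text \<open>The supremum is taken in the reals. It is used only for smooth and strongly convex
  functions, for which the set is bounded above.\<close>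
definition fenchel_dual :: "(ell2 \<Rightarrow> real) \<Rightarrow> ell2 \<Rightarrow> real" where
  "fenchel_dual h y = (SUP x. inner y x - h x)"

section \<open>Graphs and gossip matrices\<close>

text \<open>Nodes are the numbers below \<open>m\<close>; an undirected edge is stored in both orientations.\<close>
definition undirected_graph :: "nat \<Rightarrow> (nat \<times> nat) set \<Rightarrow> bool" where
  "undirected_graph m E \<longleftrightarrow> E \<subseteq> {..<m} \<times> {..<m} \<and> sym E \<and> irrefl E"

definition neighbors :: "(nat \<times> nat) set \<Rightarrow> nat \<Rightarrow> nat set" where
  "neighbors E i = {j. (i, j) \<in> E}"

definition gossip_matrix :: "nat \<Rightarrow> (nat \<times> nat) set \<Rightarrow> real mat \<Rightarrow> bool" where
  "gossip_matrix m E W \<longleftrightarrow> W \<in> carrier_mat m m \<and>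
     (\<forall>i<m. \<forall>j<m. i \<noteq> j \<and> (i, j) \<notin> E \<longrightarrow> W $$ (i, j) = 0) \<and>
     mat_kernel W = {x \<in> carrier_vec m. \<forall>i<m. \<forall>j<m. vec_index x i = vec_index x j}"

definition symmetric_psd :: "nat \<Rightarrow> real mat \<Rightarrow> bool" where
  "symmetric_psd m W \<longleftrightarrow> W \<in> carrier_mat m m \<and> transpose_mat W = W \<and>
     (\<forall>v\<in>carrier_vec m. 0 \<le> scalar_prod v (W *\<^sub>v v))"

definition chi :: "real mat \<Rightarrow> real" where
  "chi W = Max {l. eigenvalue W l} / Min {l. eigenvalue W l \<and> 0 < l}"

section \<open>Decentralized first-order methods\<close>

text \<open>Node \<open>i\<close> holds \<open>node_fun P i\<close>; \<open>edges_at P k\<close> and \<open>gossip_at P k\<close> are the graph and the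
  gossip matrix at time step \<open>k\<close>, where local computations and communication rounds both count
  as time steps.\<close>
record problem =
  num_nodes :: nat
  node_fun :: "nat \<Rightarrow> ell2 \<Rightarrow> real"
  edges_at :: "nat \<Rightarrow> (nat \<times> nat) set"
  gossip_at :: "nat \<Rightarrow> real mat"

definition problem_class :: "real \<Rightarrow> real \<Rightarrow> real \<Rightarrow> problem set" where
  "problem_class \<chi> L \<mu> = {P.
     1 \<le> num_nodes P \<and>
     (\<forall>i<num_nodes P. smooth_fun L (node_fun P i) \<and> strongly_convex \<mu> (node_fun P i)) \<and>
     (\<forall>k. undirected_graph (num_nodes P) (edges_at P k) \<and>
          gossip_matrix (num_nodes P) (edges_at P k) (gossip_at P k) \<and>
          symmetric_psd (num_nodes P) (gossip_at P k) \<and>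
          chi (gossip_at P k) = \<chi>)}"

definition average_fun :: "problem \<Rightarrow> ell2 \<Rightarrow> real" where
  "average_fun P x = (1 / real (num_nodes P)) * (\<Sum>i<num_nodes P. node_fun P i x)"

text \<open>\<open>communicates R k\<close> says whether step \<open>k\<close> is a communication round (otherwise it is a local
  computation); \<open>local_memory R k i\<close> is the memory of node \<open>i\<close> at step \<open>k\<close>.\<close>
record run =
  communicates :: "nat \<Rightarrow> bool"
  local_memory :: "nat \<Rightarrow> nat \<Rightarrow> ell2 set"
  output_at :: "nat \<Rightarrow> ell2"

text \<open>The current step is included, so that during a communication round the last communication
  time is the round itself and the graph in use is the current one.\<close>
definition last_comm_time :: "run \<Rightarrow> nat \<Rightarrow> nat" where
  "last_comm_time R k = (GREATEST t. t \<le> k \<and> communicates R t)"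

text \<open>The memory at step \<open>k\<close> is the result of the steps before \<open>k\<close>.\<close>
definition comm_rounds :: "run \<Rightarrow> nat \<Rightarrow> nat" where
  "comm_rounds R k = card {t. t < k \<and> communicates R t}"

definition first_order_run :: "ell2 \<Rightarrow> problem \<Rightarrow> run \<Rightarrow> bool" where
  "first_order_run x0 P R \<longleftrightarrow>
     (\<forall>i<num_nodes P. local_memory R 0 i = {x0}) \<and>
     (\<forall>k. \<forall>i<num_nodes P. \<not> communicates R k \<longrightarrow>
        local_memory R (Suc k) i \<subseteq>
          span (\<Union>x\<in>local_memory R k i.
            {x, gradient (node_fun P i) x, gradient (fenchel_dual (node_fun P i)) x})) \<and>
     (\<forall>k. \<forall>i<num_nodes P. communicates R k \<longrightarrow>
        local_memory R (Suc k) i \<subseteq>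
          span (\<Union>j\<in>neighbors (edges_at P (last_comm_time R k)) i \<union> {i}. local_memory R k j)) \<and>
     (\<forall>k. \<exists>i<num_nodes P. output_at R k \<in> local_memory R k i)"

text \<open>A method maps every problem of a class to a run. It may use all of the problem data, with one
  exception: whether it communicates at step \<open>k\<close> does not depend on the networks of later
  steps. With foreknowledge of the network it could wait for favorable graphs without
  communicating.\<close>
definition decentralized_method :: "problem set \<Rightarrow> ell2 \<Rightarrow> (problem \<Rightarrow> run) \<Rightarrow> bool" where
  "decentralized_method \<C> x0 M \<longleftrightarrow>
     (\<forall>P\<in>\<C>. first_order_run x0 P (M P)) \<and>
     (\<forall>P\<in>\<C>. \<forall>Q\<in>\<C>. \<forall>k.
        num_nodes P = num_nodes Q \<and> node_fun P = node_fun Q \<and>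
        (\<forall>t\<le>k. edges_at P t = edges_at Q t \<and> gossip_at P t = gossip_at Q t) \<longrightarrow>
        communicates (M P) k = communicates (M Q) k)"

end

theory Submission
  imports Defs
begin

text \<open>
  The hard function is Nesterov's: a quadratic whose Hessian is, up to scaling and a multiple of the
  identity, the Laplacian of an infinite path on orthonormal vectors \<open>e 0, e 1, \<dots>\<close> orthogonal to \<open>x0\<close>. Its minimizer
  is \<open>x0 + (\<Sum>n. q ^ n *\<^sub>R e n)\<close> with \<open>1 - q\<close> of order \<open>sqrt (\<mu> / L)\<close>, so a point of the span of \<open>x0\<close>
  and the first \<open>n\<close> vectors \<open>e i\<close> has squared relative error at least \<open>q ^ (2 * n)\<close> (\<open>distance_reach\<close>).

  The edges of the path are split between two groups of nodes: one group knows the edges that start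
  at an even index, the other those that start at an odd index. Each part of the Laplacian is a
  multiple of an orthogonal projection, so gradients and dual gradients of a node only mix the two
  ends of its own edges, and local computation extends the known initial segment by at most one vector,
  after which the other group has to act. It remains to make the exchange between the two groups cost about
  \<open>\<chi>\<close> rounds.

  For this, a third group of \<open>p\<close> nodes with \<open>p\<close> of order \<open>\<chi> / 3\<close> holds trivial functions, and in every
  round the network is a star whose center is the next node of this group, in cyclic order. A center that has not
  been informed yet learns the news, but what it broadcasts is old. Only after \<open>p\<close> rounds is every
  node of the third group informed, and the news can cross. Hence \<open>r\<close> rounds reveal at most \<open>r div p + 1\<close> vectors
  (\<open>memory_reach\<close>).

  A star on \<open>m\<close> nodes has condition number \<open>m\<close>; a negatively weighted edge between two leaves of the same
  group lowers the smallest positive eigenvalue and gives any prescribed larger value (\<open>chi_star\<close>). The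
  centers must change with the rounds, not with time, so the network sequence is adapted to the method:
  whether the method communicates depends only on the present and past networks, and the required sequence is
  obtained as a fixed point (\<open>adapted_schedule\<close>).
\<close>

section \<open>Quadratic functions with two curvatures\<close>

lemma GDERIV_of_quadratic_remainder:
  fixes f :: "'a::real_inner \<Rightarrow> real"
  assumes "\<And>h. \<bar>f (x + h) - f x - inner h D\<bar> \<le> K * (norm h)\<^sup>2"
  shows "GDERIV f x :> D"
  unfolding gderiv_def
proof (rule has_derivativeI_sandwich[where e = 1 and H = "\<lambda>y. \<bar>K\<bar> * norm (y - x)"])
  show "bounded_linear (\<lambda>h. inner h D)"
    by (rule bounded_linear_inner_left)
  show "norm (f y - f x - inner (y - x) D) / norm (y - x) \<le> \<bar>K\<bar> * norm (y - x)"
    if "y \<noteq> x" for y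
  proof -
    have "\<bar>f y - f x - inner (y - x) D\<bar> \<le> K * (norm (y - x))\<^sup>2"
      using assms[of "y - x"] by simp
    also have "\<dots> \<le> \<bar>K\<bar> * (norm (y - x))\<^sup>2"
      by (simp add: mult_right_mono)
    finally show ?thesis
      using that by (simp add: divide_le_eq power2_eq_square mult.assoc)
  qed
  have "((\<lambda>y. \<bar>K\<bar> * norm (y - x)) \<longlongrightarrow> \<bar>K\<bar> * norm (x - x)) (at x)"
    by (intro tendsto_intros)
  then show "((\<lambda>y. \<bar>K\<bar> * norm (y - x)) \<longlongrightarrow> 0) (at x)" by simp
qed simp

lemma gradient_eqI: "GDERIV h x :> D \<Longrightarrow> gradient h x = D"
  unfolding gradient_def
proof (rule the_equality)
  fix E assume D: "GDERIV h x :> D" and E: "GDERIV h x :> E"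
  then have "(\<lambda>h. inner h D) = (\<lambda>h. inner h E)"
    unfolding gderiv_def by (rule has_derivative_unique)
  then have "inner (E - D) D = inner (E - D) E" by meson
  then have "inner (E - D) (E - D) = 0" by (simp add: inner_diff_right)
  then show "E = D" by simp
qed

lemma GDERIV_quadratic:
  fixes B :: "'a::real_inner \<Rightarrow> 'a"
  assumes "linear B" and sym: "\<And>x y. inner (B x) y = inner x (B y)"
    and bound: "\<And>x. norm (B x) \<le> K * norm x"
  shows "GDERIV (\<lambda>x. inner (B (x - a)) (x - a) / 2 + inner b (x - a) + r) x :> B (x - a) + b"
proof (rule GDERIV_of_quadratic_remainder)
  interpret linear B by fact
  fix h
  let ?q = "\<lambda>x. inner (B (x - a)) (x - a) / 2 + inner b (x - a) + r"
  have "B (x + h - a) = B (x - a) + B h"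
    by (simp add: add[symmetric] algebra_simps)
  then have "?q (x + h) - ?q x - inner h (B (x - a) + b) = inner (B h) h / 2"
    using sym[of h "x - a"]
    by (simp add: inner_add_left inner_add_right inner_diff_left inner_diff_right
        inner_commute field_simps)
  then have "\<bar>?q (x + h) - ?q x - inner h (B (x - a) + b)\<bar> = \<bar>inner (B h) h\<bar> / 2"
    by (simp only: abs_divide)
  also have "\<dots> \<le> norm (B h) * norm h / 2"
    by (simp add: Cauchy_Schwarz_ineq2)
  also have "\<dots> \<le> K * norm h * norm h / 2"
    using mult_right_mono[OF bound[of h], of "norm h"] by simp
  finally show "\<bar>?q (x + h) - ?q x - inner h (B (x - a) + b)\<bar> \<le> K / 2 * (norm h)\<^sup>2"
    by (simp add: power2_eq_square)
qed

locale orthogonal_projection =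
  fixes P :: "'a::real_inner \<Rightarrow> 'a"
  assumes lin: "linear P"
    and selfadjoint: "inner (P x) y = inner x (P y)"
    and idem: "P (P x) = P x"
begin

lemmas proj_add = linear_add[OF lin] and proj_scale = linear_scale[OF lin]
  and proj_diff = linear_diff[OF lin]

lemma inner_self: "inner (P x) x = (norm (P x))\<^sup>2"
  using selfadjoint[of "P x" x] by (simp add: idem power2_norm_eq_inner)

end

text \<open>If \<open>P\<close> is an orthogonal projection, this is the self-adjoint operator with eigenvalue \<open>t\<close> on the range of
  \<open>P\<close> and \<open>s\<close> on its orthogonal complement. Inverting it inverts the two eigenvalues, so an inverse
  Hessian is again affine in \<open>P\<close>; this is what makes dual gradients as harmless as primal ones.\<close>

definition two_level :: "('a::real_inner \<Rightarrow> 'a) \<Rightarrow> real \<Rightarrow> real \<Rightarrow> 'a \<Rightarrow> 'a" where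
  "two_level P s t y = s *\<^sub>R (y - P y) + t *\<^sub>R P y"

definition two_level_fun ::
    "('a::real_inner \<Rightarrow> 'a) \<Rightarrow> real \<Rightarrow> real \<Rightarrow> 'a \<Rightarrow> 'a \<Rightarrow> 'a \<Rightarrow> real" where
  "two_level_fun P s t a b x = inner (two_level P s t (x - a)) (x - a) / 2 - inner b (x - a)"

context orthogonal_projection
begin

lemma linear_two_level: "linear (two_level P s t)"
  by (rule linearI) (simp_all add: two_level_def proj_add proj_scale algebra_simps)

lemma two_level_selfadjoint: "inner (two_level P s t x) y = inner x (two_level P s t y)"
  by (simp add: two_level_def inner_add_left inner_add_right inner_diff_left inner_diff_right
      selfadjoint)

text \<open>On each of the two eigenspaces the composition multiplies by \<open>s * (1 / s)\<close> or \<open>t * (1 / t)\<close>.\<close>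

lemma two_level_inverse:
  "s \<noteq> 0 \<Longrightarrow> t \<noteq> 0 \<Longrightarrow> two_level P s t (two_level P (1 / s) (1 / t) y) = y"
  by (simp add: two_level_def proj_add proj_scale proj_diff idem scaleR_diff_right scaleR_add_right)

lemma norm_two_level_le:
  assumes "0 \<le> s" "0 \<le> t" shows "norm (two_level P s t y) \<le> max s t * norm y"
proof (rule power2_le_imp_le)
  have orth: "inner (y - P y) (P y) = 0"
    by (simp add: inner_diff_left inner_self inner_commute[of y] power2_norm_eq_inner)
  have pyth: "(norm (two_level P s t y))\<^sup>2 = s\<^sup>2 * (norm (y - P y))\<^sup>2 + t\<^sup>2 * (norm (P y))\<^sup>2"
    for s t
    unfolding two_level_def power2_norm_eq_inner
    using orth inner_commute[of "P y" "y - P y"]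
    by (simp only: inner_add_left inner_add_right inner_scaleR_left inner_scaleR_right
        power2_eq_square) simp
  have one: "two_level P 1 1 y = y" by (simp add: two_level_def)
  have "(norm (two_level P s t y))\<^sup>2
      \<le> (max s t)\<^sup>2 * (norm (y - P y))\<^sup>2 + (max s t)\<^sup>2 * (norm (P y))\<^sup>2"
    unfolding pyth using assms by (intro add_mono mult_right_mono power_mono) auto
  also have "\<dots> = (max s t)\<^sup>2 * (norm y)\<^sup>2"
    using pyth[of 1 1] by (simp add: one distrib_left)
  finally show "(norm (two_level P s t y))\<^sup>2 \<le> (max s t * norm y)\<^sup>2"
    by (simp add: power_mult_distrib)
qed (use assms in auto)

lemma inner_two_level_ge:
  assumes "s \<le> t" shows "s * (norm y)\<^sup>2 \<le> inner (two_level P s t y) y"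
proof -
  have "inner (two_level P s t y) y = s * (norm y)\<^sup>2 + (t - s) * (norm (P y))\<^sup>2"
    by (simp add: two_level_def inner_add_left inner_diff_left inner_self power2_norm_eq_inner
        algebra_simps)
  then show ?thesis using assms by simp
qed

end

locale ell2_projection = orthogonal_projection P for P :: "ell2 \<Rightarrow> ell2" +
  fixes \<mu> L :: real
  assumes \<mu>: "0 < \<mu>" and \<mu>_le: "\<mu> \<le> L"
begin

abbreviation "A \<equiv> two_level P \<mu> L"
abbreviation "Ainv \<equiv> two_level P (1 / \<mu>) (1 / L)"
abbreviation "F \<equiv> two_level_fun P \<mu> L"

lemma GDERIV_two_level_fun: "GDERIV (F a b) x :> A (x - a) - b"
  using GDERIV_quadratic[OF linear_two_level two_level_selfadjoint norm_two_level_le,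
      of \<mu> L a "- b" 0 x] \<mu> \<mu>_le
  by (simp add: two_level_fun_def[abs_def])

lemma gradient_two_level_fun: "gradient (F a b) x = A (x - a) - b"
  by (rule gradient_eqI) (rule GDERIV_two_level_fun)

lemma differentiable_two_level_fun: "differentiable_fun (F a b)"
  using GDERIV_two_level_fun unfolding differentiable_fun_def by blast

lemma smooth_two_level_fun: "smooth_fun L (F a b)"
  unfolding smooth_fun_def gradient_two_level_fun
proof (intro conjI allI differentiable_two_level_fun)
  interpret A: linear A by (rule linear_two_level)
  fix x y
  have "A (y - a) - b - (A (x - a) - b) = A (y - x)"
    by (simp add: A.diff[symmetric])
  then show "norm (A (y - a) - b - (A (x - a) - b)) \<le> L * norm (y - x)"
    using norm_two_level_le[of \<mu> L "y - x"] \<mu> \<mu>_le by simp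
qed

text \<open>The second-order expansion is exact. Strong convexity and, later, the optimality of a stationary
  point are both read off from it.\<close>

lemma two_level_fun_expand:
  "F a b y = F a b x + inner (A (x - a) - b) (y - x) + inner (A (y - x)) (y - x) / 2"
proof -
  interpret A: linear A by (rule linear_two_level)
  have "A (y - a) = A (y - x) + A (x - a)"
    by (simp add: A.add[symmetric])
  moreover have "y - a = (y - x) + (x - a)" by simp
  ultimately have "inner (A (y - a)) (y - a) = inner (A (y - x)) (y - x)
      + 2 * inner (A (x - a)) (y - x) + inner (A (x - a)) (x - a)"
    using two_level_selfadjoint[of \<mu> L "y - x" "x - a"]
    by (simp only: inner_add_left inner_add_right inner_commute[of "y - x"])
  then show ?thesis
    by (simp add: two_level_fun_def inner_diff_left inner_diff_right field_simps)
qed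

lemma strongly_convex_two_level_fun: "strongly_convex \<mu> (F a b)"
  unfolding strongly_convex_def gradient_two_level_fun
proof (intro conjI allI differentiable_two_level_fun)
  fix x y
  show "F a b x + inner (A (x - a) - b) (y - x) + \<mu> / 2 * (norm (y - x))\<^sup>2 \<le> F a b y"
    using inner_two_level_ge[OF \<mu>_le, of "y - x"] two_level_fun_expand[of a b y x] by simp
qed

text \<open>Completing the square: \<open>inner z x - F a b x\<close> is the value below minus half of \<open>inner (A w) w\<close>, where
  \<open>w\<close> is the difference of \<open>x\<close> and \<open>a + Ainv (z + b)\<close>. So the supremum is attained there, and the
  dual is a quadratic with Hessian \<open>Ainv\<close>, written in the form that \<open>GDERIV_quadratic\<close> expects.\<close>

lemma fenchel_dual_two_level_fun:
  "fenchel_dual (F a b) z = inner (Ainv (z - (- b))) (z - (- b)) / 2 + inner a (z - (- b)) + (- inner a b)"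
proof -
  interpret A: linear A by (rule linear_two_level)
  define u where "u = Ainv (z + b)"
  have Au: "A u = z + b" unfolding u_def using \<mu> \<mu>_le by (intro two_level_inverse) auto
  have key: "inner z x - F a b x = inner (Ainv (z - (- b))) (z - (- b)) / 2 + inner a (z - (- b))
      + (- inner a b) - inner (A (x - a - u)) (x - a - u) / 2" for x
  proof -
    define y where "y = x - a"
    have x: "x = y + a" by (simp add: y_def)
    have "inner (A (y - u)) (y - u) = inner (A y) y - 2 * inner (z + b) y + inner (z + b) u"
      using two_level_selfadjoint[of \<mu> L u y]
      by (simp only: A.diff inner_diff_left inner_diff_right Au) (simp add: inner_commute)
    moreover have "x - a - u = y - u" "x - a = y" by (simp_all add: y_def)
    moreover have "Ainv (z - - b) = u" by (simp add: u_def)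
    ultimately show ?thesis
      by (simp add: two_level_fun_def) (simp add: x inner_add_left inner_add_right inner_commute field_simps)
  qed
  show ?thesis
    unfolding fenchel_dual_def
  proof (rule cSup_eq_maximum)
    show "inner (Ainv (z - (- b))) (z - (- b)) / 2 + inner a (z - (- b)) + (- inner a b)
        \<in> range (\<lambda>x. inner z x - F a b x)"
      by (rule image_eqI[of _ _ "a + u"]) (simp_all add: key A.zero)
    have "0 \<le> inner (A y) y" for y
      using inner_two_level_ge[OF \<mu>_le, of y] \<mu>
      by (meson mult_nonneg_nonneg less_imp_le order_trans zero_le_power2)
    then show "v \<le> inner (Ainv (z - (- b))) (z - (- b)) / 2 + inner a (z - (- b)) + (- inner a b)"
      if "v \<in> range (\<lambda>x. inner z x - F a b x)" for v
      using that unfolding key by auto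
  qed
qed

lemma gradient_fenchel_dual: "gradient (fenchel_dual (F a b)) z = Ainv (z + b) + a"
proof -
  have "GDERIV (fenchel_dual (F a b)) z :> Ainv (z - (- b)) + a"
    unfolding fenchel_dual_two_level_fun[abs_def] using \<mu> \<mu>_le
    by (intro GDERIV_quadratic[OF linear_two_level two_level_selfadjoint norm_two_level_le]) auto
  then show ?thesis by (simp add: gradient_eqI)
qed

end

section \<open>Involutions of coordinates and isometries of the sequence space\<close>

lemma ell2_eqI: "(\<And>n. coord x n = coord y n) \<Longrightarrow> x = y"
  by (simp add: coord_inject[symmetric] fun_eq_iff)

lemma coord_simps [simp]:
  "coord 0 n = 0" "coord (x + y) n = coord x n + coord y n"
  "coord (x - y) n = coord x n - coord y n" "coord (r *\<^sub>R x) n = r * coord x n"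
  by (simp_all add: zero_ell2.rep_eq plus_ell2.rep_eq minus_ell2.rep_eq scaleR_ell2.rep_eq)

lemma summable_coord: "summable (\<lambda>n. (coord x n)\<^sup>2)"
  using coord[of x] by simp

lemma inner_sums: "(\<lambda>n. coord x n * coord y n) sums inner x y"
  unfolding inner_ell2.rep_eq by (intro summable_sums summable_coord_mult summable_coord)

lemma norm_sums: "(\<lambda>n. (coord x n)\<^sup>2) sums (norm x)\<^sup>2"
  using inner_sums[of x x] unfolding power2_norm_eq_inner by (simp add: power2_eq_square)

text \<open>The functions must be built on orthonormal vectors orthogonal to \<open>x0\<close>: since memories are closed
  under linear span, every multiple of \<open>x0\<close> is available to every node, and it must not reveal
  anything about the hidden coordinates. The \<open>n\<close>-th vector is taken in the plane of the coordinates \<open>2 n\<close> and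
  \<open>2 n + 1\<close>, orthogonal there to the corresponding part of \<open>x0\<close>; different vectors have disjoint
  supports. \<open>E\<close> sends the standard basis to these vectors and \<open>T\<close> is its adjoint.\<close>

lemma ell2_isometry_orthogonal:
  obtains E T :: "ell2 \<Rightarrow> ell2" where "linear E" "linear T"
    "\<And>z y. inner (E z) y = inner z (T y)" "\<And>z. T (E z) = z" "T x0 = 0"
proof -
  have "\<exists>\<alpha> \<beta>. \<alpha>\<^sup>2 + \<beta>\<^sup>2 = 1 \<and> \<alpha> * a + \<beta> * b = (0::real)" for a b
  proof (cases "a = 0 \<and> b = 0")
    case True then show ?thesis by (intro exI[of _ 1] exI[of _ 0]) simp
  next
    case False
    define r where "r = sqrt (a\<^sup>2 + b\<^sup>2)"
    have "0 < a\<^sup>2 + b\<^sup>2" using False by (simp add: sum_power2_gt_zero_iff)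
    then have r: "r \<noteq> 0" "r\<^sup>2 = b\<^sup>2 + a\<^sup>2" using False by (simp_all add: r_def)
    have "(b / r)\<^sup>2 + (- a / r)\<^sup>2 = (b\<^sup>2 + a\<^sup>2) / r\<^sup>2"
      by (simp add: power_divide add_divide_distrib)
    moreover have "(b / r) * a + (- a / r) * b = 0" by simp
    ultimately show ?thesis using r by (metis divide_self power_not_zero)
  qed
  then have "\<forall>n. \<exists>\<alpha> \<beta>. \<alpha>\<^sup>2 + \<beta>\<^sup>2 = 1 \<and> \<alpha> * coord x0 (2 * n) + \<beta> * coord x0 (2 * n + 1) = 0"
    by blast
  then obtain \<alpha> \<beta> :: "nat \<Rightarrow> real" where unit: "\<And>n. (\<alpha> n)\<^sup>2 + (\<beta> n)\<^sup>2 = 1"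
    and orth: "\<And>n. \<alpha> n * coord x0 (2 * n) + \<beta> n * coord x0 (2 * n + 1) = 0"
    by metis
  have \<alpha>: "(\<alpha> n * r)\<^sup>2 \<le> r\<^sup>2" and \<beta>: "(\<beta> n * r)\<^sup>2 \<le> r\<^sup>2" for n r
  proof -
    have "(\<alpha> n)\<^sup>2 \<le> 1" "(\<beta> n)\<^sup>2 \<le> 1"
      using unit[of n] zero_le_power2[of "\<alpha> n"] zero_le_power2[of "\<beta> n"] by linarith+
    then show "(\<alpha> n * r)\<^sup>2 \<le> r\<^sup>2" "(\<beta> n * r)\<^sup>2 \<le> r\<^sup>2"
      using mult_right_mono[of "(\<alpha> n)\<^sup>2" 1 "r\<^sup>2"] mult_right_mono[of "(\<beta> n)\<^sup>2" 1 "r\<^sup>2"]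
      by (simp_all add: power_mult_distrib)
  qed
  have weighted: "summable (\<lambda>n. (\<alpha> n * z n)\<^sup>2)" "summable (\<lambda>n. (\<beta> n * z n)\<^sup>2)"
    if "summable (\<lambda>n. (z n)\<^sup>2)" for z
    using that \<alpha> \<beta> by (auto intro: summable_comparison_test'[of _ 0])
  define E where "E z = Abs_ell2 (\<lambda>k. if even k then \<alpha> (k div 2) * coord z (k div 2)
      else \<beta> ((k - 1) div 2) * coord z ((k - 1) div 2))" for z
  define T where "T y = Abs_ell2 (\<lambda>n. \<alpha> n * coord y (2 * n) + \<beta> n * coord y (2 * n + 1))" for y
  have coord_E: "coord (E z) k = (if even k then \<alpha> (k div 2) * coord z (k div 2)
      else \<beta> ((k - 1) div 2) * coord z ((k - 1) div 2))" for z k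
  proof -
    have "summable (\<lambda>k. if even k then (\<alpha> (k div 2) * coord z (k div 2))\<^sup>2
        else (\<beta> ((k - 1) div 2) * coord z ((k - 1) div 2))\<^sup>2)"
      using sums_if[OF summable_sums[OF weighted(2)] summable_sums[OF weighted(1)],
          OF summable_coord summable_coord]
      by (rule sums_summable)
    then show ?thesis unfolding E_def
      by (subst Abs_ell2_inverse) (auto simp: if_distrib[of "\<lambda>x. x\<^sup>2"] cong: if_cong)
  qed
  have coord_T: "coord (T y) n = \<alpha> n * coord y (2 * n) + \<beta> n * coord y (2 * n + 1)" for y n
  proof -
    have "summable ((\<lambda>n. (coord y n)\<^sup>2) \<circ> (\<lambda>n. 2 * n))" "summable ((\<lambda>n. (coord y n)\<^sup>2) \<circ> (\<lambda>n. 2 * n + 1))"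
      by (intro summable_reindex summable_coord; simp add: inj_def)+
    then have "summable (\<lambda>n. (\<alpha> n * coord y (2 * n) + \<beta> n * coord y (2 * n + 1))\<^sup>2)"
      by (intro summable_square_add weighted) (simp_all add: o_def)
    then show ?thesis unfolding T_def by (subst Abs_ell2_inverse) auto
  qed
  show thesis
  proof (rule that[of E T])
    show "linear E" by (rule linearI; rule ell2_eqI) (auto simp: coord_E algebra_simps)
    show "linear T" by (rule linearI; rule ell2_eqI) (auto simp: coord_T algebra_simps)
    show "T (E z) = z" for z
    proof (rule ell2_eqI)
      fix n
      have "coord (T (E z)) n = ((\<alpha> n)\<^sup>2 + (\<beta> n)\<^sup>2) * coord z n"
        by (simp add: coord_T coord_E power2_eq_square algebra_simps)
      then show "coord (T (E z)) n = coord z n" by (simp add: unit)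
    qed
    show "T x0 = 0" by (rule ell2_eqI) (use orth in \<open>simp add: coord_T\<close>)
    show "inner (E z) y = inner z (T y)" for z y
    proof -
      have sq: "summable (\<lambda>n. (coord y (2 * n))\<^sup>2)" "summable (\<lambda>n. (coord y (2 * n + 1))\<^sup>2)"
        using summable_reindex[OF summable_coord[of y], of "\<lambda>n. 2 * n"]
          summable_reindex[OF summable_coord[of y], of "\<lambda>n. 2 * n + 1"]
        by (simp_all add: inj_def o_def)
      define f where "f n = coord z n * (\<alpha> n * coord y (2 * n))" for n
      define g where "g n = coord z n * (\<beta> n * coord y (2 * n + 1))" for n
      have "summable f" "summable g" unfolding f_def g_def
        by (intro summable_coord_mult summable_coord weighted sq)+
      then have "f sums suminf f" "g sums suminf g" by (simp_all add: summable_sums)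
      then have "(\<lambda>k. if even k then f (k div 2) else g ((k - 1) div 2)) sums (suminf g + suminf f)"
        and "(\<lambda>n. f n + g n) sums (suminf f + suminf g)"
        by (rule sums_if[rotated], rule sums_add)
      moreover have "(\<lambda>k. if even k then f (k div 2) else g ((k - 1) div 2))
          = (\<lambda>k. coord (E z) k * coord y k)"
        by (auto simp: fun_eq_iff f_def g_def coord_E)
      moreover have "(\<lambda>n. f n + g n) = (\<lambda>n. coord z n * coord (T y) n)"
        by (auto simp: fun_eq_iff f_def g_def coord_T algebra_simps)
      ultimately show ?thesis
        using inner_sums[of "E z" y] inner_sums[of z "T y"]
        by (metis add.commute sums_unique2)
    qed
  qed
qed

lift_definition reindex :: "(nat \<Rightarrow> nat) \<Rightarrow> ell2 \<Rightarrow> ell2" is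
  "\<lambda>\<sigma> x n. if inj \<sigma> then x (\<sigma> n) else 0"
  subgoal for \<sigma> x
    using summable_reindex[of "\<lambda>n. (x n)\<^sup>2" \<sigma>] by (cases "inj \<sigma>") (simp_all add: o_def)
  done

locale involution =
  fixes \<sigma> :: "nat \<Rightarrow> nat"
  assumes invol: "\<sigma> (\<sigma> n) = n"
begin

lemma coord_reindex [simp]: "coord (reindex \<sigma> x) n = coord x (\<sigma> n)"
proof -
  have "inj \<sigma>" by (metis injI invol)
  then show ?thesis by (simp add: reindex.rep_eq)
qed

lemma norm_reindex: "norm (reindex \<sigma> x) = norm x"
proof -
  have "surj \<sigma>" "inj \<sigma>" by (metis surjI invol, metis injI invol)
  then have "suminf ((\<lambda>n. (coord x n)\<^sup>2) \<circ> \<sigma>) = (\<Sum>n. (coord x n)\<^sup>2)"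
    by (intro suminf_reindex summable_coord) auto
  then have "(norm (reindex \<sigma> x))\<^sup>2 = (norm x)\<^sup>2"
    using norm_sums[of x] norm_sums[of "reindex \<sigma> x"] by (simp add: sums_iff o_def)
  then show ?thesis by simp
qed

text \<open>An isometric involution is self-adjoint, by polarization.\<close>

lemma inner_reindex_swap: "inner (reindex \<sigma> x) y = inner x (reindex \<sigma> y)"
proof -
  have "(norm (reindex \<sigma> x + y))\<^sup>2 = (norm (x + reindex \<sigma> y))\<^sup>2"
  proof -
    have "reindex \<sigma> (reindex \<sigma> x + y) = x + reindex \<sigma> y"
      by (rule ell2_eqI) (simp add: invol)
    then show ?thesis by (metis norm_reindex)
  qed
  moreover have "inner (reindex \<sigma> z) (reindex \<sigma> z) = inner z z" for z
    using norm_reindex[of z] by (metis power2_norm_eq_inner)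
  ultimately show ?thesis
    unfolding power2_norm_eq_inner
    by (simp add: inner_add_left inner_add_right inner_commute)
qed

text \<open>For an involution that exchanges disjoint pairs, this is the orthogonal projection onto the span of
  the differences of paired basis vectors; fixed points contribute nothing.\<close>

definition antisym_part :: "ell2 \<Rightarrow> ell2" where
  "antisym_part x = (1 / 2) *\<^sub>R (x - reindex \<sigma> x)"

lemma coord_antisym_part [simp]: "coord (antisym_part x) n = (coord x n - coord x (\<sigma> n)) / 2"
  by (simp add: antisym_part_def)

sublocale orthogonal_projection antisym_part
proof
  show "antisym_part (antisym_part x) = antisym_part x" for x
    by (rule ell2_eqI) (simp add: invol field_simps)
  show "inner (antisym_part x) y = inner x (antisym_part y)" for x y
    by (simp add: antisym_part_def inner_diff_left inner_diff_right inner_reindex_swap)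
qed (rule ell2_eqI; simp add: algebra_simps add_divide_distrib diff_divide_distrib)+

end

section \<open>The gossip matrix of a star\<close>

text \<open>A star with center \<open>c\<close>, plus the edge between the nodes \<open>0\<close> and \<open>1\<close>. The extra edge lets the condition
  number be tuned to a prescribed real value.\<close>

definition star_edges :: "nat \<Rightarrow> nat \<Rightarrow> (nat \<times> nat) set" where
  "star_edges m c = {(i, j). i < m \<and> j < m \<and> i \<noteq> j \<and> (i = c \<or> j = c \<or> i \<le> 1 \<and> j \<le> 1)}"

text \<open>The Laplacian of the star minus \<open>\<beta> * d * d\<^sup>T\<close>, where \<open>d\<close> is the difference of the basis vectors \<open>0\<close> and
  \<open>1\<close>. As \<open>d\<close> is an eigenvector of the star Laplacian with eigenvalue \<open>1\<close>, only the eigenvalue of \<open>d\<close> moves, to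
  \<open>1 - 2 * \<beta>\<close>; the largest eigenvalue stays \<open>m\<close>.\<close>

definition star_matrix :: "nat \<Rightarrow> real \<Rightarrow> nat \<Rightarrow> real mat" where
  "star_matrix m \<beta> c = mat m m (\<lambda>(i, j).
     (if i = j then (if i = c then real m - 1 else 1) else if i = c \<or> j = c then - 1 else 0)
     - \<beta> * (of_bool (i = 0) - of_bool (i = 1)) * (of_bool (j = 0) - of_bool (j = 1)))"

lemma undirected_star: "undirected_graph m (star_edges m c)"
  by (auto simp: undirected_graph_def star_edges_def sym_def irrefl_def)

locale tied_star =
  fixes m c :: nat and \<beta> :: real
  assumes m: "4 \<le> m" and c: "2 \<le> c" "c < m" and \<beta>: "0 \<le> \<beta>" "\<beta> < 1 / 2"
begin

abbreviation "W \<equiv> star_matrix m \<beta> c"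

lemma W_carrier [simp]: "W \<in> carrier_mat m m"
  by (simp add: star_matrix_def)

lemma W_mult:
  assumes v: "v \<in> carrier_vec m" and i: "i < m"
  shows "(W *\<^sub>v v) $ i = (if i = c then real m * v $ c - (\<Sum>j<m. v $ j) else v $ i - v $ c)
           - \<beta> * (of_bool (i = 0) - of_bool (i = 1)) * (v $ 0 - v $ 1)"
proof -
  let ?d = "\<lambda>i. of_bool (i = 0) - of_bool (i = 1) :: real"
  let ?l = "\<lambda>i j. (if i = j then (if i = c then real m - 1 else 1) else if i = c \<or> j = c then - 1 else 0) :: real"
  have d: "(\<Sum>j<m. ?d j * v $ j) = v $ 0 - v $ 1"
    using m by (simp add: of_bool_def left_diff_distrib sum_subtractf if_distrib[of "\<lambda>x. x * _"] cong: if_cong)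
  have l: "(\<Sum>j<m. ?l i j * v $ j) = (if i = c then real m * v $ c - (\<Sum>j<m. v $ j) else v $ i - v $ c)"
  proof (cases "i = c")
    case True
    have "?l i j * v $ j = (if j = c then real m * v $ c else 0) - v $ j" for j
      using True by (auto simp: algebra_simps)
    then show ?thesis using True c by (simp add: sum_subtractf)
  next
    case False
    have "?l i j * v $ j = (if j = i then v $ i else 0) - (if j = c then v $ c else 0)" for j
      using False by auto
    then show ?thesis using False c i by (simp add: sum_subtractf)
  qed
  have dim: "dim_row W = m" "dim_col W = m" "dim_vec v = m" using v by (auto simp: star_matrix_def)
  have "(W *\<^sub>v v) $ i = (\<Sum>j<m. W $$ (i, j) * v $ j)"
    using i by (simp add: dim scalar_prod_def lessThan_atLeast0)
  also have "\<dots> = (\<Sum>j<m. (?l i j - \<beta> * ?d i * ?d j) * v $ j)"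
    using i unfolding star_matrix_def by (intro sum.cong arg_cong2[of _ _ _ _ "(*)"]) (simp_all only: index_mat lessThan_iff split)
  also have "\<dots> = (\<Sum>j<m. ?l i j * v $ j - \<beta> * ?d i * (?d j * v $ j))"
    by (intro sum.cong refl) (simp only: left_diff_distrib[of "?l i _"] mult.assoc)
  also have "\<dots> = (\<Sum>j<m. ?l i j * v $ j) - \<beta> * ?d i * (\<Sum>j<m. ?d j * v $ j)"
    by (simp only: sum_subtractf sum_distrib_left)
  finally show ?thesis unfolding d l .
qed

text \<open>Away from the eigenvalues \<open>1 - 2 * \<beta>\<close> and \<open>1\<close>, an eigenvector takes one value \<open>s\<close> on all leaves and
  \<open>(1 - l) * s\<close> at the center, and then the equation at the center leaves only \<open>l = 0\<close> and \<open>l = m\<close>. The case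
  \<open>l = 0\<close> of the second conclusion is the computation of the kernel.\<close>

lemma eigen_cases:
  assumes v: "v \<in> carrier_vec m" and eq: "W *\<^sub>v v = l \<cdot>\<^sub>v v"
    and l: "l \<noteq> 1 - 2 * \<beta>" "l \<noteq> 1" "l \<noteq> real m"
  shows "(l = 0 \<or> v = 0\<^sub>v m) \<and> (\<forall>i<m. i \<noteq> c \<longrightarrow> (1 - l) * v $ i = v $ c)"
proof -
  have at: "(if i = c then real m * v $ c - (\<Sum>j<m. v $ j) else v $ i - v $ c)
           - \<beta> * (of_bool (i = 0) - of_bool (i = 1)) * (v $ 0 - v $ 1) = l * v $ i" if "i < m" for i
    using W_mult[OF v that] that v by (simp add: eq)
  have "(1 - 2 * \<beta> - l) * (v $ 0 - v $ 1) = 0"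
    using at[of 0] at[of 1] m c by (simp add: algebra_simps)
  then have tie: "v $ 0 = v $ 1" using l by simp
  have leaf: "(1 - l) * v $ i = v $ c" if "i < m" "i \<noteq> c" for i
    using at[of i] that tie by (simp add: algebra_simps)
  define s where "s = v $ c / (1 - l)"
  have vs: "v $ i = s" if "i < m" "i \<noteq> c" for i
    using leaf[OF that] l by (simp add: s_def field_simps)
  have vc: "v $ c = (1 - l) * s" using l by (simp add: s_def)
  have "(\<Sum>j<m. v $ j) = v $ c + (\<Sum>j\<in>{..<m} - {c}. v $ j)"
    using c by (intro sum.remove) auto
  also have "(\<Sum>j\<in>{..<m} - {c}. v $ j) = (real m - 1) * s"
    using vs c by (simp add: of_nat_diff)
  finally have "real m * ((1 - l) * s) - ((1 - l) * s + (real m - 1) * s) = l * ((1 - l) * s)"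
    using at[of c] c tie by (simp add: vc)
  moreover have "l * (l - real m) * s
      = real m * ((1 - l) * s) - ((1 - l) * s + (real m - 1) * s) - l * ((1 - l) * s)"
    by (simp add: algebra_simps)
  ultimately have "l * (l - real m) * s = 0" by simp
  then have "l = 0 \<or> s = 0" using l by simp
  moreover have "v = 0\<^sub>v m" if "s = 0"
    using that v vs vc by (metis eq_vecI carrier_vecD index_zero_vec mult_zero_right)
  ultimately show ?thesis using leaf by blast
qed

lemma eigenvalue_cases: "eigenvalue W l \<Longrightarrow> l \<in> {0, 1 - 2 * \<beta>, 1, real m}"
proof (rule ccontr)
  assume "eigenvalue W l" and l: "l \<notin> {0, 1 - 2 * \<beta>, 1, real m}"
  then obtain v where v: "v \<in> carrier_vec m" "v \<noteq> 0\<^sub>v m" "W *\<^sub>v v = l \<cdot>\<^sub>v v"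
    unfolding eigenvalue_def eigenvector_def carrier_matD(1)[OF W_carrier] by blast
  have "l = 0 \<or> v = 0\<^sub>v m"
    using eigen_cases[OF v(1) v(3)] l by simp
  then show False using l v(2) by simp
qed

lemma eigenvalue_m: "eigenvalue W (real m)"
proof -
  define v where "v = vec m (\<lambda>i. if i = c then real m - 1 else - 1)"
  have [simp]: "v \<in> carrier_vec m" by (simp add: v_def)
  have v: "v $ i = (if i = c then real m - 1 else - 1)" if "i < m" for i
    using that by (simp add: v_def)
  have s: "(\<Sum>j<m. v $ j) = 0"
  proof -
    have "(\<Sum>j<m. v $ j) = (\<Sum>j<m. (if j = c then real m else 0) - 1)"
      by (intro sum.cong) (auto simp: v)
    then show ?thesis using c by (simp add: sum_subtractf)
  qed
  have "W *\<^sub>v v = real m \<cdot>\<^sub>v v"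
  proof (rule eq_vecI)
    fix i assume "i < dim_vec (real m \<cdot>\<^sub>v v)"
    then have i: "i < m" by (simp add: v_def)
    have "v $ 0 - v $ 1 = 0" using v m c by simp
    then show "(W *\<^sub>v v) $ i = (real m \<cdot>\<^sub>v v) $ i"
      using W_mult[of v i] i s v[of i] v[of c] c by (auto simp: v_def)
  qed (simp add: v_def star_matrix_def)
  moreover have "v \<noteq> 0\<^sub>v m"
  proof
    assume "v = 0\<^sub>v m"
    then have "v $ 0 = 0" using m by simp
    then show False using v[of 0] m c by simp
  qed
  ultimately show ?thesis
    unfolding eigenvalue_def eigenvector_def by (intro exI[of _ v]) (auto simp: star_matrix_def)
qed

lemma eigenvalue_tie: "eigenvalue W (1 - 2 * \<beta>)"
proof -
  define v where "v = vec m (\<lambda>i. of_bool (i = 0) - of_bool (i = 1) :: real)"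
  have [simp]: "v \<in> carrier_vec m" by (simp add: v_def)
  have v: "v $ i = of_bool (i = 0) - of_bool (i = 1)" if "i < m" for i
    using that by (simp add: v_def)
  have s: "(\<Sum>j<m. v $ j) = 0"
    using m by (simp add: v sum_subtractf of_bool_def)
  have "W *\<^sub>v v = (1 - 2 * \<beta>) \<cdot>\<^sub>v v"
  proof (rule eq_vecI)
    fix i assume "i < dim_vec ((1 - 2 * \<beta>) \<cdot>\<^sub>v v)"
    then have i: "i < m" by (simp add: v_def)
    have vs: "v $ 0 = 1" "v $ 1 = - 1" "v $ c = 0" using v m c by simp_all
    moreover have "((1 - 2 * \<beta>) \<cdot>\<^sub>v v) $ i = (1 - 2 * \<beta>) * v $ i"
      by (rule index_smult_vec(1)) (simp add: v_def i)
    ultimately show "(W *\<^sub>v v) $ i = ((1 - 2 * \<beta>) \<cdot>\<^sub>v v) $ i"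
      using W_mult[of v i] i s v[of i] vs c
      by (cases "i = 0"; cases "i = 1"; cases "i = c") (simp_all add: algebra_simps)
  qed (simp add: v_def star_matrix_def)
  moreover have "v \<noteq> 0\<^sub>v m"
  proof
    assume "v = 0\<^sub>v m"
    then have "v $ 0 = 0" using m by simp
    then show False using v[of 0] m by simp
  qed
  ultimately show ?thesis
    unfolding eigenvalue_def eigenvector_def by (intro exI[of _ v]) (auto simp: star_matrix_def)
qed

lemma chi_star: "chi W = real m / (1 - 2 * \<beta>)"
proof -
  have fin: "finite {l. eigenvalue W l}" "finite {l. eigenvalue W l \<and> 0 < l}"
    using eigenvalue_cases by (auto intro: finite_subset[of _ "{0, 1 - 2 * \<beta>, 1, real m}"])
  have "Max {l. eigenvalue W l} = real m"
    using fin eigenvalue_m eigenvalue_cases m \<beta> by (intro Max_eqI) force+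
  moreover have "Min {l. eigenvalue W l \<and> 0 < l} = 1 - 2 * \<beta>"
    using fin eigenvalue_tie eigenvalue_cases m \<beta> by (intro Min_eqI) force+
  ultimately show ?thesis by (simp add: chi_def)
qed

lemma gossip_star: "gossip_matrix m (star_edges m c) W"
  unfolding gossip_matrix_def
proof (intro conjI allI impI W_carrier)
  show "W $$ (i, j) = 0" if "i < m" "j < m" "i \<noteq> j \<and> (i, j) \<notin> star_edges m c" for i j
    using that by (auto simp: star_matrix_def star_edges_def of_bool_def)
  show "mat_kernel W = {x \<in> carrier_vec m. \<forall>i<m. \<forall>j<m. x $ i = x $ j}"
  proof (intro Set.equalityI subsetI)
    fix v assume "v \<in> mat_kernel W"
    then have v: "v \<in> carrier_vec m" "W *\<^sub>v v = 0\<^sub>v m"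
      using mat_kernelD[OF W_carrier] by auto
    then have "W *\<^sub>v v = 0 \<cdot>\<^sub>v v" by auto
    then have "\<forall>i<m. i \<noteq> c \<longrightarrow> v $ i = v $ c"
      using eigen_cases[OF v(1), of 0] m \<beta> by simp
    then show "v \<in> {x \<in> carrier_vec m. \<forall>i<m. \<forall>j<m. x $ i = x $ j}"
      using v by simp metis
  next
    fix v :: "real vec" assume "v \<in> {x \<in> carrier_vec m. \<forall>i<m. \<forall>j<m. x $ i = x $ j}"
    then have v: "v \<in> carrier_vec m" and const: "\<And>i j. i < m \<Longrightarrow> j < m \<Longrightarrow> v $ i = v $ j"
      by blast+
    have "(W *\<^sub>v v) $ i = 0" if "i < m" for i
    proof -
      have "(\<Sum>j<m. v $ j) = (\<Sum>j<m. v $ c)"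
        by (intro sum.cong refl const) (use c in auto)
      then show ?thesis
        using W_mult[OF v that] const[of 0 1] const[of i c] that m c by simp
    qed
    then have "W *\<^sub>v v = 0\<^sub>v m" by (intro eq_vecI) (auto simp: star_matrix_def)
    then show "v \<in> mat_kernel W" by (intro mat_kernelI[OF W_carrier v])
  qed
qed

text \<open>The quadratic form is the sum of \<open>(v i - v c)\<^sup>2\<close> over all nodes minus \<open>\<beta> * (v 0 - v 1)\<^sup>2\<close>. As
  \<open>2 * \<beta> \<le> 1\<close>, the two summands of the leaves \<open>0\<close> and \<open>1\<close> already dominate the subtracted term.\<close>

lemma psd_star: "symmetric_psd m W"
  unfolding symmetric_psd_def
proof (intro conjI ballI W_carrier)
  show "transpose_mat W = W"
    by (rule eq_matI) (auto simp: star_matrix_def)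
  fix v :: "real vec" assume v: "v \<in> carrier_vec m"
  let ?d = "\<lambda>i. of_bool (i = 0) - of_bool (i = 1) :: real"
  have "v \<bullet> (W *\<^sub>v v) = (\<Sum>i<m. v $ i * ((W *\<^sub>v v) $ i))"
    by (simp only: scalar_prod_def dim_mult_mat_vec carrier_matD(1)[OF W_carrier] lessThan_atLeast0)
  also have "\<dots> = (\<Sum>i<m. (v $ i - v $ c)\<^sup>2 + (if i = c then v $ c * (real m * v $ c - (\<Sum>j<m. v $ j)) else 0)
      + v $ c * (v $ i - v $ c) - \<beta> * (v $ 0 - v $ 1) * (?d i * v $ i))"
  proof (rule sum.cong)
    fix i assume "i \<in> {..<m}"
    then show "v $ i * ((W *\<^sub>v v) $ i) = (v $ i - v $ c)\<^sup>2
        + (if i = c then v $ c * (real m * v $ c - (\<Sum>j<m. v $ j)) else 0)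
        + v $ c * (v $ i - v $ c) - \<beta> * (v $ 0 - v $ 1) * (?d i * v $ i)"
      by (cases "i = c") (simp_all add: W_mult[OF v] power2_eq_square algebra_simps)
  qed simp
  also have "\<dots> = (\<Sum>i<m. (v $ i - v $ c)\<^sup>2) - \<beta> * (v $ 0 - v $ 1) * (\<Sum>i<m. ?d i * v $ i)"
  proof -
    have "v $ c * (real m * v $ c - (\<Sum>j<m. v $ j)) + v $ c * (\<Sum>i<m. v $ i - v $ c) = 0"
      by (simp add: sum_subtractf algebra_simps)
    then show ?thesis
      using c by (simp only: sum.distrib sum_subtractf sum_distrib_left[symmetric]) simp
  qed
  also have "(\<Sum>j<m. ?d j * v $ j) = v $ 0 - v $ 1"
    using m by (simp add: of_bool_def left_diff_distrib sum_subtractf if_distrib[of "\<lambda>x. x * _"] cong: if_cong)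
  finally have eq: "v \<bullet> (W *\<^sub>v v) = (\<Sum>i<m. (v $ i - v $ c)\<^sup>2) - \<beta> * (v $ 0 - v $ 1)\<^sup>2"
    by (simp add: power2_eq_square)
  have "\<beta> * (v $ 0 - v $ 1)\<^sup>2 \<le> 1 / 2 * (v $ 0 - v $ 1)\<^sup>2"
    using \<beta> by (intro mult_right_mono) auto
  also have "\<dots> \<le> (v $ 0 - v $ c)\<^sup>2 + (v $ 1 - v $ c)\<^sup>2"
    using zero_le_power2[of "(v $ 0 - v $ c) + (v $ 1 - v $ c)"]
    by (simp add: power2_eq_square algebra_simps)
  also have "\<dots> = (\<Sum>i\<in>{0, 1}. (v $ i - v $ c)\<^sup>2)" by simp
  also have "\<dots> \<le> (\<Sum>i<m. (v $ i - v $ c)\<^sup>2)"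
    using m by (intro sum_mono2) auto
  finally show "0 \<le> v \<bullet> (W *\<^sub>v v)" by (simp add: eq)
qed

end

section \<open>Paths of coordinates\<close>

text \<open>The pairs of the two involutions are disjoint, and together they are the edges of the path
  \<open>0, 1, 2, \<dots>\<close>; each of the two informed groups of nodes knows the pairs of one of them.\<close>

definition even_swap :: "nat \<Rightarrow> nat" where
  "even_swap n = (if even n then n + 1 else n - 1)"

definition odd_swap :: "nat \<Rightarrow> nat" where
  "odd_swap n = (if n = 0 then 0 else if odd n then n + 1 else n - 1)"

interpretation even_swap: involution even_swap
proof
  show "even_swap (even_swap n) = n" for n
    by (cases "even n") (simp_all add: even_swap_def)
qed

interpretation odd_swap: involution odd_swap
proof
  show "odd_swap (odd_swap n) = n" for n
  proof (cases n)
    case (Suc k) then show ?thesis by (cases "even k") (auto simp: odd_swap_def odd_pos)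
  qed (simp add: odd_swap_def)
qed

text \<open>The parity barrier: no pair of \<open>even_swap\<close> straddles an even threshold, and no pair of \<open>odd_swap\<close>
  straddles an odd one. So a vector supported below such a threshold stays there.\<close>

lemma even_swap_ge: "even n \<Longrightarrow> n \<le> j \<Longrightarrow> n \<le> even_swap j"
  by (cases "even j"; cases "n = j") (auto simp: even_swap_def)

lemma odd_swap_ge: "odd n \<Longrightarrow> n \<le> j \<Longrightarrow> n \<le> odd_swap j"
  by (cases "odd j"; cases "n = j") (auto simp: odd_swap_def)

text \<open>The geometric sequence with ratio \<open>q\<close>; \<open>powers 0\<close> is the first basis vector, since \<open>0 ^ 0 = 1\<close>.\<close>

definition powers :: "real \<Rightarrow> ell2" where
  "powers q = Abs_ell2 (\<lambda>n. q ^ n)"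

lemma coord_powers:
  assumes "\<bar>q\<bar> < 1" shows "coord (powers q) n = q ^ n"
proof -
  have "summable (\<lambda>n. (q\<^sup>2) ^ n)"
    using assms by (intro summable_geometric) (simp add: abs_square_less_1)
  then show ?thesis
    unfolding powers_def by (subst Abs_ell2_inverse) (simp_all add: power_mult[symmetric] mult.commute)
qed

lemma coord_unit: "coord (powers 0) n = of_bool (n = 0)"
  by (simp add: coord_powers)

text \<open>Only the coordinates from \<open>n\<close> on count, where \<open>z\<close> vanishes; the tail of a geometric sequence is the
  sequence itself scaled by \<open>q ^ n\<close>.\<close>

lemma powers_tail:
  assumes q: "\<bar>q\<bar> < 1" and z: "\<And>j. n \<le> j \<Longrightarrow> coord z j = 0"
  shows "q ^ (2 * n) * (norm (powers q))\<^sup>2 \<le> (norm (z - powers q))\<^sup>2"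
proof -
  let ?d = "\<lambda>j. (coord (z - powers q) j)\<^sup>2"
  have "(\<lambda>j. q ^ (2 * n) * (coord (powers q) j)\<^sup>2) sums (q ^ (2 * n) * (norm (powers q))\<^sup>2)"
    by (intro sums_mult norm_sums)
  moreover have "q ^ (2 * n) * (coord (powers q) j)\<^sup>2 = ?d (j + n)" for j
    using z[of "j + n"] q by (simp add: coord_powers power_mult_distrib power_add power_mult algebra_simps
        flip: power_mult)
  ultimately have "q ^ (2 * n) * (norm (powers q))\<^sup>2 = (\<Sum>j. ?d (j + n))"
    by (simp add: sums_iff)
  also have "\<dots> \<le> (\<Sum>j. ?d j)"
    unfolding suminf_split_initial_segment[OF summable_coord, of "z - powers q" n]
    by (simp add: sum_nonneg)
  also have "\<dots> = (norm (z - powers q))\<^sup>2"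
    using norm_sums[of "z - powers q"] by (simp add: sums_iff)
  finally show ?thesis .
qed

section \<open>The hard problem\<close>

text \<open>The adversary answers the past behaviour of the method. Since that behaviour is itself a function of
  the whole network sequence, the sequence is a fixed point, which exists because step \<open>k\<close> of the
  answer depends only on the steps before \<open>k\<close>.\<close>

lemma causal_fixpoint:
  fixes \<Phi> :: "(nat \<Rightarrow> 'a) \<Rightarrow> nat \<Rightarrow> 'a"
  assumes "\<And>f g k. (\<And>t. t < k \<Longrightarrow> f t = g t) \<Longrightarrow> \<Phi> f k = \<Phi> g k"
  shows "\<exists>f. \<forall>k. f k = \<Phi> f k"
proof (rule dependent_wellorder_choice)
  show "(r = \<Phi> f k) = (r = \<Phi> g k)" if "\<And>t. t < k \<Longrightarrow> f t = g t" for r f g k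
    using assms[OF that] by simp
qed simp

lemma sum_thirds:
  fixes a b c :: "'a::real_vector"
  shows "(\<Sum>i<3 * p. if i < p then a else if i < 2 * p then b else c) = real p *\<^sub>R (a + b + c)"
proof -
  let ?f = "\<lambda>i. if i < p then a else if i < 2 * p then b else c"
  have "sum ?f {0..<p} + sum ?f {p..<2 * p} = sum ?f {0..<2 * p}"
    and "sum ?f {0..<2 * p} + sum ?f {2 * p..<3 * p} = sum ?f {0..<3 * p}"
    by (rule sum.atLeastLessThan_concat; simp)+
  then have "sum ?f {0..<3 * p} = sum ?f {0..<p} + sum ?f {p..<2 * p} + sum ?f {2 * p..<3 * p}"
    by (simp only:)
  also have "\<dots> = (\<Sum>i\<in>{0..<p}. a) + (\<Sum>i\<in>{p..<2 * p}. b) + (\<Sum>i\<in>{2 * p..<3 * p}. c)"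
    by (intro arg_cong2[where f = "(+)"] sum.cong) auto
  finally show ?thesis
    by (simp add: sum_constant_scaleR scaleR_add_right lessThan_atLeast0)
qed

text \<open>The equation for \<open>q\<close> is the characteristic equation of the recurrence that the coordinates of the
  minimizer satisfy.\<close>

locale hard_instance =
  fixes x0 :: ell2 and E T :: "ell2 \<Rightarrow> ell2" and \<mu> L q \<beta> :: real and p :: nat
  assumes linear_E: "linear E" and linear_T: "linear T"
    and adjoint: "inner (E z) y = inner z (T y)" and T_E: "T (E z) = z" and T_x0: "T x0 = 0"
    and \<mu>: "0 < \<mu>" and \<mu>_le: "\<mu> \<le> L"
    and q: "0 < q" "q < 1" and q_eq: "(L - \<mu>) * (1 - q)\<^sup>2 = 6 * \<mu> * q"
    and p: "2 \<le> p" and \<beta>: "0 \<le> \<beta>" "\<beta> < 1 / 2"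
begin

lemmas E_add = linear_add[OF linear_E] and E_diff = linear_diff[OF linear_E]
  and E_scale = linear_scale[OF linear_E] and E_zero = linear_0[OF linear_E]
lemmas T_add = linear_add[OF linear_T] and T_scale = linear_scale[OF linear_T]
  and T_zero = linear_0[OF linear_T]

definition coupling :: "(nat \<Rightarrow> nat) \<Rightarrow> ell2 \<Rightarrow> ell2" where
  "coupling \<sigma> y = E (involution.antisym_part \<sigma> (T y))"

lemma coupling_projection:
  assumes "involution \<sigma>" shows "ell2_projection (coupling \<sigma>) \<mu> L"
proof -
  interpret involution \<sigma> by fact
  show ?thesis
  proof
    show "coupling \<sigma> (x + y) = coupling \<sigma> x + coupling \<sigma> y" for x y
      by (simp add: coupling_def E_add T_add proj_add)
    show "coupling \<sigma> (r *\<^sub>R x) = r *\<^sub>R coupling \<sigma> x" for r x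
      by (simp add: coupling_def E_scale T_scale proj_scale)
    show "inner (coupling \<sigma> x) y = inner x (coupling \<sigma> y)" for x y
      unfolding coupling_def by (metis adjoint inner_commute selfadjoint)
    show "coupling \<sigma> (coupling \<sigma> x) = coupling \<sigma> x" for x
      by (simp add: coupling_def T_E idem)
  qed (use \<mu> \<mu>_le in auto)
qed

lemma zero_projection: "ell2_projection (\<lambda>_. 0) \<mu> L"
  by standard (use \<mu> \<mu>_le in auto)

text \<open>The \<open>3 * p\<close> nodes form three groups: those below \<open>p\<close> see the pairs of \<open>even_swap\<close>, those from \<open>p\<close> to
  \<open>2 * p - 1\<close> see the pairs of \<open>odd_swap\<close>, and the rest see none and serve as relays between the two.\<close>

definition node_proj :: "nat \<Rightarrow> ell2 \<Rightarrow> ell2" where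
  "node_proj i = (if i < p then coupling even_swap else if i < 2 * p then coupling odd_swap
     else (\<lambda>_. 0))"

text \<open>The coefficient is chosen to balance the stationarity equation at coordinate \<open>0\<close>.\<close>

definition source :: ell2 where
  "source = (3 * \<mu> + (L - \<mu>) * (1 - q) / 2) *\<^sub>R E (powers 0)"

definition node_source :: "nat \<Rightarrow> ell2" where
  "node_source i = (if i < p then 0 else if i < 2 * p then source else 0)"

text \<open>The parameter \<open>s\<close> is meant to give, at each time step, the number of communication rounds so far. The relays take turns
  as the center of the star. Reducing modulo \<open>p\<close> makes every \<open>s\<close> yield a legitimate problem.\<close>

definition hard_problem :: "(nat \<Rightarrow> nat) \<Rightarrow> problem" where
  "hard_problem s =
    \<lparr>num_nodes = 3 * p,
     node_fun = (\<lambda>i. two_level_fun (node_proj i) \<mu> L x0 (node_source i)),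
     edges_at = (\<lambda>k. star_edges (3 * p) (2 * p + s k mod p)),
     gossip_at = (\<lambda>k. star_matrix (3 * p) \<beta> (2 * p + s k mod p))\<rparr>"

lemma node_projection: "ell2_projection (node_proj i) \<mu> L"
  unfolding node_proj_def
  using coupling_projection[OF even_swap.involution_axioms]
    coupling_projection[OF odd_swap.involution_axioms] zero_projection by simp

lemma hard_problem_in_class:
  "hard_problem s \<in> problem_class (3 * real p / (1 - 2 * \<beta>)) L \<mu>"
proof -
  have star: "tied_star (3 * p) (2 * p + s k mod p) \<beta>" for k
    using p \<beta> by unfold_locales auto
  show ?thesis
    using p ell2_projection.smooth_two_level_fun[OF node_projection]
      ell2_projection.strongly_convex_two_level_fun[OF node_projection]
      undirected_star tied_star.gossip_star[OF star] tied_star.psd_star[OF star] tied_star.chi_star[OF star]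
    by (simp add: problem_class_def hard_problem_def)
qed

definition minimizer :: ell2 where
  "minimizer = x0 + E (powers q)"

text \<open>In the coordinates along the range of \<open>E\<close>, the sum of the two pair projections is the path Laplacian divided
  by \<open>2\<close>. Away from the start of the path, a geometric sequence solves the equation
  because of the characteristic equation of \<open>q\<close>; at coordinate \<open>0\<close> the source compensates.\<close>

lemma stationary:
  "(\<Sum>i<3 * p. two_level (node_proj i) \<mu> L (minimizer - x0) - node_source i) = 0"
proof -
  let ?t = "powers q"
  have c: "coord ?t n = q ^ n" for n using q by (intro coord_powers) simp
  have balance: "3 * \<mu> * q ^ n + (L - \<mu>) * (coord (even_swap.antisym_part ?t) n
      + coord (odd_swap.antisym_part ?t) n)
      = (3 * \<mu> + (L - \<mu>) * (1 - q) / 2) * coord (powers 0) n" for n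
  proof (cases n)
    case 0
    then show ?thesis
      by (simp add: c coord_unit even_swap_def odd_swap_def)
  next
    case (Suc k)
    have pair: "coord (even_swap.antisym_part ?t) n + coord (odd_swap.antisym_part ?t) n
        = (2 * q ^ Suc k - q ^ k - q ^ Suc (Suc k)) / 2"
      using Suc by (cases "even k") (simp_all add: c even_swap_def odd_swap_def field_simps)
    have "(2 * q ^ Suc k - q ^ k - q ^ Suc (Suc k)) / 2 = - (q ^ k * (1 - q)\<^sup>2 / 2)"
      by (simp add: power2_eq_square field_simps)
    then have "3 * \<mu> * q ^ n + (L - \<mu>) * ((2 * q ^ Suc k - q ^ k - q ^ Suc (Suc k)) / 2)
        = q ^ k * (6 * \<mu> * q - (L - \<mu>) * (1 - q)\<^sup>2) / 2"
      by (simp only: Suc) (simp add: field_simps)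
    then show ?thesis
      unfolding pair using Suc by (simp add: q_eq coord_unit)
  qed
  have diff: "minimizer - x0 = E ?t" by (simp add: minimizer_def)
  have step: "coupling \<sigma> (E ?t) = E (involution.antisym_part \<sigma> ?t)" for \<sigma>
    by (simp add: coupling_def T_E)
  have "(\<Sum>i<3 * p. two_level (node_proj i) \<mu> L (minimizer - x0) - node_source i)
      = (\<Sum>i<3 * p. if i < p then two_level (coupling even_swap) \<mu> L (E ?t)
          else if i < 2 * p then two_level (coupling odd_swap) \<mu> L (E ?t) - source
          else two_level (\<lambda>_. 0) \<mu> L (E ?t))"
    unfolding diff by (intro sum.cong) (auto simp: node_proj_def node_source_def)
  also have "\<dots> = real p *\<^sub>R (two_level (coupling even_swap) \<mu> L (E ?t)
      + (two_level (coupling odd_swap) \<mu> L (E ?t) - source) + two_level (\<lambda>_. 0) \<mu> L (E ?t))"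
    by (rule sum_thirds)
  also have "two_level (coupling even_swap) \<mu> L (E ?t)
      + (two_level (coupling odd_swap) \<mu> L (E ?t) - source) + two_level (\<lambda>_. 0) \<mu> L (E ?t)
      = E ((3 * \<mu>) *\<^sub>R ?t + (L - \<mu>) *\<^sub>R (even_swap.antisym_part ?t + odd_swap.antisym_part ?t)
          - (3 * \<mu> + (L - \<mu>) * (1 - q) / 2) *\<^sub>R powers 0)"
  proof -
    have "(3 * \<mu>) *\<^sub>R v = \<mu> *\<^sub>R v + \<mu> *\<^sub>R v + \<mu> *\<^sub>R v" for v :: ell2
      by (simp flip: scaleR_add_left)
    then show ?thesis
      unfolding two_level_def step source_def E_add E_diff E_scale
      by (simp only:) (simp add: algebra_simps)
  qed
  also have "(3 * \<mu>) *\<^sub>R ?t + (L - \<mu>) *\<^sub>R (even_swap.antisym_part ?t + odd_swap.antisym_part ?t)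
          - (3 * \<mu> + (L - \<mu>) * (1 - q) / 2) *\<^sub>R powers 0 = 0"
    by (rule ell2_eqI) (use balance c in \<open>simp only: coord_simps diff_self\<close>)
  finally show ?thesis by (simp add: E_zero)
qed

text \<open>Each node function lies above its linearization at the stationary point, and the linear parts sum to
  zero.\<close>

lemma minimizer: "is_arg_min (average_fun (hard_problem s)) (\<lambda>_. True) minimizer"
proof -
  let ?f = "\<lambda>i. two_level_fun (node_proj i) \<mu> L x0 (node_source i)"
  have "(\<Sum>i<3 * p. ?f i minimizer) \<le> (\<Sum>i<3 * p. ?f i x)" for x
  proof -
    let ?g = "\<lambda>i. two_level (node_proj i) \<mu> L (minimizer - x0) - node_source i"
    have "?f i minimizer + inner (?g i) (x - minimizer) \<le> ?f i x" for i
    proof -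
      interpret ell2_projection "node_proj i" \<mu> L by (rule node_projection)
      have "0 \<le> \<mu> * (norm (x - minimizer))\<^sup>2" using \<mu> by simp
      then show ?thesis
        using two_level_fun_expand[of x0 "node_source i" x minimizer]
          inner_two_level_ge[OF \<mu>_le, of "x - minimizer"] by linarith
    qed
    then have "(\<Sum>i<3 * p. ?f i minimizer + inner (?g i) (x - minimizer)) \<le> (\<Sum>i<3 * p. ?f i x)"
      by (intro sum_mono)
    then show ?thesis
      by (simp add: sum.distrib stationary flip: inner_sum_left)
  qed
  then have "average_fun (hard_problem s) minimizer \<le> average_fun (hard_problem s) x" for x
    unfolding average_fun_def by (intro mult_left_mono) (simp_all add: hard_problem_def)
  then show ?thesis by (auto simp: is_arg_min_def not_less)
qed

text \<open>The span of \<open>x0\<close> and of the first \<open>n\<close> hidden basis vectors.\<close>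

definition reach :: "nat \<Rightarrow> ell2 set" where
  "reach n = {a *\<^sub>R x0 + E z | a z. \<forall>j\<ge>n. coord z j = 0}"

lemma reach_mono: "m \<le> n \<Longrightarrow> reach m \<subseteq> reach n"
  unfolding reach_def by (auto intro: order_trans)

lemma subspace_reach: "Real_Vector_Spaces.subspace (reach n)"
proof (rule real_vector.subspaceI)
  show "0 \<in> reach n"
    unfolding reach_def by (rule CollectI, rule exI[of _ 0], rule exI[of _ 0]) (simp add: E_zero)
next
  fix x y assume "x \<in> reach n" "y \<in> reach n"
  then obtain a b z w where "x = a *\<^sub>R x0 + E z" "y = b *\<^sub>R x0 + E w"
    "\<forall>j\<ge>n. coord z j = 0" "\<forall>j\<ge>n. coord w j = 0" unfolding reach_def by blast
  then show "x + y \<in> reach n"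
    unfolding reach_def by (intro CollectI exI[of _ "a + b"] exI[of _ "z + w"]) (simp add: E_add algebra_simps)
next
  fix x and r :: real assume "x \<in> reach n"
  then obtain a z where "x = a *\<^sub>R x0 + E z" "\<forall>j\<ge>n. coord z j = 0" unfolding reach_def by blast
  then show "r *\<^sub>R x \<in> reach n"
    unfolding reach_def by (intro CollectI exI[of _ "r * a"] exI[of _ "r *\<^sub>R z"]) (simp add: E_scale algebra_simps)
qed

lemma x0_reach: "x0 \<in> reach n"
  unfolding reach_def by (rule CollectI, rule exI[of _ 1], rule exI[of _ 0]) (simp add: E_zero)

lemma coupling_reach:
  assumes "involution \<sigma>" and "\<And>j. n \<le> j \<Longrightarrow> n \<le> \<sigma> j" and "x \<in> reach n"
  shows "coupling \<sigma> x \<in> reach n"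
proof -
  interpret involution \<sigma> by fact
  obtain a z where x: "x = a *\<^sub>R x0 + E z" and z: "\<forall>j\<ge>n. coord z j = 0"
    using assms(3) unfolding reach_def by blast
  have "coupling \<sigma> x = 0 *\<^sub>R x0 + E (antisym_part z)"
    by (simp add: coupling_def x T_add T_scale T_x0 T_E)
  moreover have "\<forall>j\<ge>n. coord (antisym_part z) j = 0" using z assms(2) by simp
  ultimately show ?thesis unfolding reach_def by blast
qed

lemma source_reach: "1 \<le> n \<Longrightarrow> source \<in> reach n"
  unfolding source_def
  by (intro real_vector.subspace_scale[OF subspace_reach])
    (auto simp: reach_def coord_unit intro!: exI[of _ 0] exI[of _ "powers 0"])

text \<open>The part along \<open>x0\<close> is orthogonal to the range of \<open>E\<close>, so it can only increase the distance; the rest is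
  \<open>powers_tail\<close>, transported by the isometry \<open>E\<close>.\<close>

lemma distance_reach:
  assumes "x \<in> reach n"
  shows "q ^ (2 * n) * (norm (x0 - minimizer))\<^sup>2 \<le> (norm (x - minimizer))\<^sup>2"
proof -
  obtain a z where x: "x = a *\<^sub>R x0 + E z" and z: "\<forall>j\<ge>n. coord z j = 0"
    using assms unfolding reach_def by blast
  have E_iso: "(norm (E w))\<^sup>2 = (norm w)\<^sup>2" for w
    by (simp add: power2_norm_eq_inner adjoint T_E)
  have "q ^ (2 * n) * (norm (x0 - minimizer))\<^sup>2 = q ^ (2 * n) * (norm (powers q))\<^sup>2"
    by (simp add: minimizer_def E_iso)
  also have "\<dots> \<le> (norm (z - powers q))\<^sup>2"
    using z q by (intro powers_tail) auto
  also have "\<dots> \<le> (a - 1)\<^sup>2 * (norm x0)\<^sup>2 + (norm (E (z - powers q)))\<^sup>2"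
    by (simp add: E_iso)
  also have "\<dots> = (norm ((a - 1) *\<^sub>R x0 + E (z - powers q)))\<^sup>2"
  proof -
    have "inner (E w) x0 = 0" for w by (simp add: adjoint T_x0)
    moreover from this have "inner x0 (E w) = 0" for w by (metis inner_commute)
    ultimately show ?thesis
      unfolding power2_norm_eq_inner
      by (simp add: inner_add_left inner_add_right power2_eq_square)
  qed
  also have "(a - 1) *\<^sub>R x0 + E (z - powers q) = x - minimizer"
    by (simp add: x minimizer_def E_diff algebra_simps)
  finally show ?thesis .
qed

text \<open>An upper bound for the number of hidden basis vectors known to node \<open>i\<close> after \<open>r\<close> communication
  rounds. Let \<open>j = r div p\<close>. The two outer groups are at the least even and the least odd number that is at least
  \<open>j\<close>, respectively: by the parity barrier one of them cannot pass \<open>j\<close> and the other cannot pass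
  \<open>j + 1\<close> by local computation. Relays that have already been the center in the current cycle of \<open>p\<close>
  rounds may have learned the vector with index \<open>j\<close>; the other relays have not.\<close>

definition level :: "nat \<Rightarrow> nat \<Rightarrow> nat" where
  "level r i = (if i < p then 2 * ((r div p + 1) div 2)
     else if i < 2 * p then 2 * (r div p div 2) + 1
     else if i - 2 * p < r mod p then r div p + 1 else r div p)"

lemma level_bounds: "r div p \<le> level r i" "level r i \<le> r div p + 1"
  unfolding level_def by auto

lemma level_mono: "level r i \<le> level (Suc r) i"
proof (cases "Suc (r mod p) = p")
  case True
  then have "Suc r div p = Suc (r div p)" by (simp add: div_Suc mod_Suc)
  then show ?thesis
    using level_bounds[of r i] level_bounds[of "Suc r" i] by simp
next
  case False
  then have "Suc r div p = r div p" "Suc r mod p = Suc (r mod p)"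
    by (simp_all add: div_Suc mod_Suc)
  then show ?thesis by (simp add: level_def)
qed

text \<open>The current center is a relay that is still at the lowest level, so its leaves learn nothing from it,
  whereas the center itself may advance. When the last relay has advanced, a new cycle begins and the lowest
  level rises by one. The nodes \<open>0\<close> and \<open>1\<close> belong to the same group and have nothing to tell each other.\<close>

lemma level_communicate:
  assumes i: "i < 3 * p" and j: "j \<in> neighbors (star_edges (3 * p) (2 * p + r mod p)) i \<union> {i}"
  shows "level r j \<le> level (Suc r) i"
proof -
  have div_le: "r div p \<le> Suc r div p" by (simp add: div_le_mono)
  have "r mod p < p" using p by simp
  consider "j = i" | "i = 2 * p + r mod p" | "j = 2 * p + r mod p" | "i \<le> 1" "j \<le> 1"
    using j by (auto simp: neighbors_def star_edges_def)
  then show ?thesis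
  proof cases
    case 1 then show ?thesis by (simp add: level_mono)
  next
    case 2
    have "r div p + 1 \<le> level (Suc r) i"
    proof (cases "Suc (r mod p) = p")
      case True
      then have "Suc r div p = Suc (r div p)" by (simp add: div_Suc mod_Suc)
      then show ?thesis using level_bounds[of "Suc r" i] by simp
    next
      case False
      then have "Suc r div p = r div p" "Suc r mod p = Suc (r mod p)"
        by (simp_all add: div_Suc mod_Suc)
      then show ?thesis using 2 by (simp add: level_def)
    qed
    then show ?thesis using level_bounds[of r j] by simp
  next
    case 3
    then have "level r j = r div p" by (simp add: level_def)
    then show ?thesis using level_bounds[of "Suc r" i] div_le by linarith
  next
    case 4
    then have "level r j = level r i" using p by (simp add: level_def)
    then show ?thesis by (simp add: level_mono)
  qed
qed

lemma node_proj_reach: "x \<in> reach (level r i) \<Longrightarrow> node_proj i x \<in> reach (level r i)"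
proof -
  assume x: "x \<in> reach (level r i)"
  consider "i < p" | "p \<le> i" "i < 2 * p" | "2 * p \<le> i" by linarith
  then show ?thesis
  proof cases
    case 1
    then have "even (level r i)" "node_proj i = coupling even_swap"
      by (simp_all add: level_def node_proj_def)
    then show ?thesis
      using coupling_reach[OF even_swap.involution_axioms even_swap_ge x] by simp
  next
    case 2
    then have "odd (level r i)" "node_proj i = coupling odd_swap"
      by (simp_all add: level_def node_proj_def)
    then show ?thesis
      using coupling_reach[OF odd_swap.involution_axioms odd_swap_ge x] by simp
  next
    case 3
    then show ?thesis by (simp add: node_proj_def real_vector.subspace_0[OF subspace_reach])
  qed
qed

lemma node_source_reach: "node_source i \<in> reach (level r i)"
  using real_vector.subspace_0[OF subspace_reach]
  by (simp add: node_source_def level_def source_reach)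

text \<open>Both gradients are affine combinations of the argument, \<open>x0\<close>, the source and their images under the
  projection of the node.\<close>

lemma gradients_reach:
  assumes x: "x \<in> reach (level r i)"
  shows "gradient (node_fun (hard_problem s) i) x \<in> reach (level r i)"
    and "gradient (fenchel_dual (node_fun (hard_problem s) i)) x \<in> reach (level r i)"
proof -
  interpret ell2_projection "node_proj i" \<mu> L by (rule node_projection)
  note closed = real_vector.subspace_add[OF subspace_reach] real_vector.subspace_diff[OF subspace_reach]
    real_vector.subspace_scale[OF subspace_reach] x0_reach node_proj_reach node_source_reach x
  show "gradient (node_fun (hard_problem s) i) x \<in> reach (level r i)"
    by (simp only: hard_problem_def problem.simps gradient_two_level_fun two_level_def)
      (intro closed)
  show "gradient (fenchel_dual (node_fun (hard_problem s) i)) x \<in> reach (level r i)"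
    by (simp only: hard_problem_def problem.simps gradient_fenchel_dual two_level_def)
      (intro closed)
qed

end

section \<open>Spread of information\<close>

lemma comm_rounds_Suc:
  "comm_rounds R (Suc k) = (if communicates R k then Suc (comm_rounds R k) else comm_rounds R k)"
proof -
  have "{t. t < Suc k \<and> communicates R t} =
      (if communicates R k then insert k {t. t < k \<and> communicates R t}
       else {t. t < k \<and> communicates R t})"
    by (auto simp: less_Suc_eq)
  then show ?thesis by (simp add: comm_rounds_def)
qed

lemma last_comm_time_now: "communicates R k \<Longrightarrow> last_comm_time R k = k"
  unfolding last_comm_time_def by (rule Greatest_equality) auto

context hard_instance
begin

text \<open>A local computation keeps the level of a node, by \<open>gradients_reach\<close>, and a round raises it as
  \<open>level_communicate\<close> permits; taking spans changes nothing because \<open>reach n\<close> is a subspace. The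
  hypothesis on \<open>s\<close> says that the relays rotate with the rounds of this very run, which keeps the
  actual centers in step with \<open>level\<close>.\<close>

lemma memory_reach:
  assumes run: "first_order_run x0 (hard_problem s) R"
    and s: "\<And>k. s k = comm_rounds R k"
  shows "i < 3 * p \<Longrightarrow> local_memory R k i \<subseteq> reach (level (comm_rounds R k) i)"
proof (induction k arbitrary: i)
  case 0
  then show ?case using run x0_reach by (simp add: first_order_run_def hard_problem_def)
next
  case (Suc k)
  show ?case
  proof (cases "communicates R k")
    case False
    have "local_memory R (Suc k) i \<subseteq> span (\<Union>x\<in>local_memory R k i.
        {x, gradient (node_fun (hard_problem s) i) x,
         gradient (fenchel_dual (node_fun (hard_problem s) i)) x})"
      using run Suc.prems False by (simp add: first_order_run_def hard_problem_def)
    also have "\<dots> \<subseteq> reach (level (comm_rounds R k) i)"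
      using Suc gradients_reach by (intro real_vector.span_minimal subspace_reach) blast
    finally show ?thesis using False by (simp add: comm_rounds_Suc)
  next
    case True
    let ?N = "neighbors (star_edges (3 * p) (2 * p + comm_rounds R k mod p)) i \<union> {i}"
    have "local_memory R (Suc k) i \<subseteq> span (\<Union>j\<in>?N. local_memory R k j)"
      using run Suc.prems True
      by (simp add: first_order_run_def hard_problem_def last_comm_time_now s)
    also have "\<dots> \<subseteq> reach (level (Suc (comm_rounds R k)) i)"
    proof (intro real_vector.span_minimal subspace_reach UN_least)
      fix j assume j: "j \<in> ?N"
      then have "j < 3 * p" using Suc.prems by (auto simp: neighbors_def star_edges_def)
      then show "local_memory R k j \<subseteq> reach (level (Suc (comm_rounds R k)) i)"
        using Suc.IH reach_mono[OF level_communicate[OF Suc.prems j]] by blast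
    qed
    finally show ?thesis using True by (simp add: comm_rounds_Suc)
  qed
qed

lemma output_error:
  assumes "first_order_run x0 (hard_problem s) R" and "\<And>k. s k = comm_rounds R k"
  shows "q ^ (2 * (comm_rounds R k div p + 1)) * (norm (x0 - minimizer))\<^sup>2
    \<le> (norm (output_at R k - minimizer))\<^sup>2"
proof -
  have "\<exists>i<3 * p. output_at R k \<in> local_memory R k i"
    using assms(1) by (simp add: first_order_run_def hard_problem_def)
  then obtain i where "i < 3 * p" "output_at R k \<in> local_memory R k i" by blast
  then have "output_at R k \<in> reach (comm_rounds R k div p + 1)"
    using memory_reach[OF assms] reach_mono[OF level_bounds(2)] by blast
  then show ?thesis by (rule distance_reach)
qed

lemma minimizer_neq: "x0 \<noteq> minimizer"
proof
  assume "x0 = minimizer"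
  then have "E (powers q) = 0" by (simp add: minimizer_def)
  then have "powers q = 0" using T_E T_zero by metis
  then have "coord (powers q) 0 = 0" by simp
  then show False using q by (simp add: coord_powers)
qed

text \<open>The count at step \<open>k\<close> involves only communication decisions before \<open>k\<close>, which a method takes from
  the networks up to that point, so \<open>causal_fixpoint\<close> applies.\<close>

lemma adapted_schedule:
  assumes "decentralized_method (problem_class (3 * real p / (1 - 2 * \<beta>)) L \<mu>) x0 M"
  shows "\<exists>s. \<forall>k. s k = comm_rounds (M (hard_problem s)) k"
proof (rule causal_fixpoint)
  fix f g :: "nat \<Rightarrow> nat" and k assume eq: "\<And>t. t < k \<Longrightarrow> f t = g t"
  have "communicates (M (hard_problem f)) t = communicates (M (hard_problem g)) t" if "t < k" for t
  proof -
    have "\<forall>u\<le>t. f u = g u" using that eq by auto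
    then have "num_nodes (hard_problem f) = num_nodes (hard_problem g) \<and>
        node_fun (hard_problem f) = node_fun (hard_problem g) \<and>
        (\<forall>u\<le>t. edges_at (hard_problem f) u = edges_at (hard_problem g) u \<and>
               gossip_at (hard_problem f) u = gossip_at (hard_problem g) u)"
      by (simp add: hard_problem_def)
    then show ?thesis
      using assms hard_problem_in_class unfolding decentralized_method_def by blast
  qed
  then have "{t. t < k \<and> communicates (M (hard_problem f)) t}
      = {t. t < k \<and> communicates (M (hard_problem g)) t}" by auto
  then show "comm_rounds (M (hard_problem f)) k = comm_rounds (M (hard_problem g)) k"
    by (simp add: comm_rounds_def)
qed

end

section \<open>The convergence rate\<close>

text \<open>Take \<open>q = 1 / s\<^sup>2\<close> with \<open>s - 1 / s = \<delta>\<close>: then \<open>(1 - q)\<^sup>2 / q = (s - 1 / s)\<^sup>2\<close>, and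
  \<open>ln (1 / q) = 2 * ln s \<le> 2 * (s - 1) \<le> 2 * \<delta>\<close>.\<close>

lemma contraction_factor:
  fixes \<delta> :: real assumes "0 < \<delta>"
  obtains q where "0 < q" "q < 1" "(1 - q)\<^sup>2 = \<delta>\<^sup>2 * q" "ln (1 / q) \<le> 2 * \<delta>"
proof -
  define s where "s = (\<delta> + sqrt (\<delta>\<^sup>2 + 4)) / 2"
  have "sqrt 4 < sqrt (\<delta>\<^sup>2 + 4)" using assms by (intro real_sqrt_less_mono) simp
  then have s1: "1 < s" using assms by (simp add: s_def)
  have "(2 * s - \<delta>)\<^sup>2 = \<delta>\<^sup>2 + 4" by (simp add: s_def add_divide_distrib)
  then have s: "s\<^sup>2 - 1 = \<delta> * s" by (simp add: power2_eq_square algebra_simps)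
  show thesis
  proof (rule that[of "1 / s\<^sup>2"])
    show "0 < 1 / s\<^sup>2" "1 / s\<^sup>2 < 1" using s1 by (simp_all add: one_less_power)
    have "(1 - 1 / s\<^sup>2)\<^sup>2 = ((s\<^sup>2 - 1) / s\<^sup>2)\<^sup>2" using s1 by (simp add: field_simps)
    also have "\<dots> = \<delta>\<^sup>2 * (1 / s\<^sup>2)"
      unfolding s using s1 by (simp add: field_simps power2_eq_square)
    finally show "(1 - 1 / s\<^sup>2)\<^sup>2 = \<delta>\<^sup>2 * (1 / s\<^sup>2)" .
    have "s - 1 \<le> \<delta>"
    proof -
      have "(s - 1) * s \<le> (s - 1) * (s + 1)" using s1 by (intro mult_left_mono) auto
      also have "\<dots> = \<delta> * s" using s by (simp add: power2_eq_square algebra_simps)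
      finally show ?thesis using s1 by simp
    qed
    then show "ln (1 / (1 / s\<^sup>2)) \<le> 2 * \<delta>"
      using s1 ln_le_minus_one[of s] by (simp add: ln_realpow)
  qed
qed

text \<open>Taking logarithms bounds \<open>r div p + 1\<close> from below by \<open>sqrt \<kappa> * ln (1 / \<epsilon>) / 12\<close>. For \<open>\<epsilon> < exp (- 6)\<close>
  and \<open>sqrt \<kappa> > 4\<close> this is at least \<open>2\<close>, so the summand \<open>1\<close> costs at most a factor \<open>2\<close>. The factor \<open>p\<close>
  is at least \<open>\<chi> / 4\<close>, and \<open>96 = 4 * 2 * 12\<close>.\<close>

lemma round_count_bound:
  fixes \<chi> \<kappa> q \<epsilon> :: real and p r :: nat
  assumes \<chi>: "56 \<le> \<chi>" and p: "\<chi> / 4 \<le> real p" and \<kappa>: "16 < \<kappa>"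
    and q: "0 < q" "q < 1" "ln (1 / q) \<le> 6 / sqrt \<kappa>"
    and \<epsilon>: "0 < \<epsilon>" "\<epsilon> < exp (- 6)" "q ^ (2 * (r div p + 1)) \<le> \<epsilon>"
  shows "1 / 96 * \<chi> * sqrt \<kappa> * ln (1 / \<epsilon>) \<le> real r"
proof -
  let ?l = "ln (1 / \<epsilon>)" and ?n = "real (r div p)"
  have k4: "4 < sqrt \<kappa>" using \<kappa> real_less_rsqrt[of 4 \<kappa>] by simp
  have l6: "6 < ?l"
    using \<epsilon> ln_less_cancel_iff[of \<epsilon> "exp (- 6)"] by (simp add: ln_div)
  have "ln (q ^ (2 * (r div p + 1))) \<le> ln \<epsilon>"
    using \<epsilon> q by (subst ln_le_cancel_iff) auto
  then have "real (2 * (r div p + 1)) * ln q \<le> ln \<epsilon>"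
    using q by (simp only: ln_realpow)
  then have "?l \<le> 2 * (?n + 1) * ln (1 / q)"
    using q \<epsilon> by (simp add: ln_realpow ln_div algebra_simps del: power_Suc)
  also have "\<dots> \<le> 2 * (?n + 1) * (6 / sqrt \<kappa>)"
    using q by (intro mult_left_mono) auto
  finally have "?l * sqrt \<kappa> \<le> 2 * (?n + 1) * (6 / sqrt \<kappa>) * sqrt \<kappa>"
    using k4 by (intro mult_right_mono) linarith+
  also have "\<dots> = 12 * (?n + 1)"
    using k4 by (cases "\<kappa> = 0") simp_all
  finally have "sqrt \<kappa> * ?l \<le> 12 * (?n + 1)" by (simp add: mult.commute)
  moreover have nonneg: "4 * 6 \<le> sqrt \<kappa> * ?l" using k4 l6 by (intro mult_mono) linarith+
  ultimately have n: "sqrt \<kappa> * ?l / 24 \<le> ?n" by simp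
  have "1 / 96 * \<chi> * sqrt \<kappa> * ?l = \<chi> / 4 * (sqrt \<kappa> * ?l / 24)" by simp
  also have "\<dots> \<le> real p * ?n"
    using p n nonneg \<chi> by (intro mult_mono) auto
  also have "\<dots> \<le> real r"
    unfolding of_nat_mult[symmetric] of_nat_le_iff by simp
  finally show ?thesis .
qed

section \<open>The lower bound\<close>

theorem corollary2p1:
  shows "\<exists>c>0::real. \<exists>\<epsilon>\<^sub>0>0::real.
    \<forall>(\<chi>::real) (L::real) (\<mu>::real) (x0::ell2) (M :: problem \<Rightarrow> run).
      56 \<le> \<chi> \<and> 0 < \<mu> \<and> 16 * \<mu> < L \<and>
      decentralized_method (problem_class \<chi> L \<mu>) x0 M \<longrightarrow>
      (\<exists>P\<in>problem_class \<chi> L \<mu>. \<exists>xs::ell2.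
         is_arg_min (average_fun P) (\<lambda>_. True) xs \<and>
         (\<forall>(\<epsilon>::real) (k::nat).
            0 < \<epsilon> \<and> \<epsilon> < \<epsilon>\<^sub>0 \<and>
            (norm (output_at (M P) k - xs))\<^sup>2 \<le> \<epsilon> * (norm (x0 - xs))\<^sup>2 \<longrightarrow>
            c * \<chi> * sqrt (L / \<mu>) * ln (1 / \<epsilon>) \<le> real (comm_rounds (M P) k)))"
proof (intro exI conjI allI impI)
  show "0 < (1 / 96 :: real)" "0 < exp (- 6 :: real)" by simp_all
  fix \<chi> L \<mu> :: real and x0 :: ell2 and M :: "problem \<Rightarrow> run"
  assume asm: "56 \<le> \<chi> \<and> 0 < \<mu> \<and> 16 * \<mu> < L \<and>
    decentralized_method (problem_class \<chi> L \<mu>) x0 M"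
  \<comment> \<open>With this \<open>\<delta>\<close> the contraction factor satisfies the characteristic equation of the path; as
    \<open>16 * \<mu> < L\<close>, this \<open>\<delta>\<close> is at most \<open>3 / sqrt (L / \<mu>)\<close>.\<close>
  define \<delta> where "\<delta> = sqrt (6 * \<mu> / (L - \<mu>))"
  have \<delta>: "0 < \<delta>" "\<delta>\<^sup>2 = 6 * \<mu> / (L - \<mu>)"
    using asm by (simp_all add: \<delta>_def)
  then obtain q where ratio: "0 < q" "q < 1" "(1 - q)\<^sup>2 = \<delta>\<^sup>2 * q" "ln (1 / q) \<le> 2 * \<delta>"
    using contraction_factor by blast
  have q_eq: "(L - \<mu>) * (1 - q)\<^sup>2 = 6 * \<mu> * q"
    using asm by (simp add: ratio \<delta>)
  have \<delta>_le: "\<delta> \<le> 3 / sqrt (L / \<mu>)"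
  proof (rule power2_le_imp_le)
    have "6 * \<mu> / (L - \<mu>) \<le> 9 * \<mu> / L"
      using asm mult_strict_left_mono[of "16 * \<mu>" L \<mu>] by (simp add: field_simps)
    then show "\<delta>\<^sup>2 \<le> (3 / sqrt (L / \<mu>))\<^sup>2"
      using asm by (simp add: \<delta> power_divide)
  qed (use asm in simp)
  define p where "p = nat \<lfloor>\<chi> / 3\<rfloor>"
  have size: "3 * real p \<le> \<chi>" "\<chi> / 4 \<le> real p" "2 \<le> p"
  proof -
    have "\<chi> / 3 - 1 < real p" "real p \<le> \<chi> / 3"
      using asm by (simp_all add: p_def) linarith+
    then show "3 * real p \<le> \<chi>" "\<chi> / 4 \<le> real p" "2 \<le> p"
      using asm by linarith+
  qed
  \<comment> \<open>The plain star has condition number \<open>3 * p \<le> \<chi>\<close>; this \<open>\<beta>\<close> raises it to exactly \<open>\<chi>\<close>.\<close>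
  define \<beta> where "\<beta> = (1 - 3 * real p / \<chi>) / 2"
  have tuned: "0 \<le> \<beta>" "\<beta> < 1 / 2" "3 * real p / (1 - 2 * \<beta>) = \<chi>"
  proof -
    have "1 - 2 * \<beta> = 3 * real p / \<chi>" by (simp add: \<beta>_def diff_divide_distrib)
    then show "3 * real p / (1 - 2 * \<beta>) = \<chi>" using asm size by simp
  qed (use asm size in \<open>simp_all add: \<beta>_def\<close>)
  obtain E T :: "ell2 \<Rightarrow> ell2" where ET: "linear E" "linear T" "\<And>z y. inner (E z) y = inner z (T y)"
    "\<And>z. T (E z) = z" "T x0 = 0"
  proof (rule ell2_isometry_orthogonal[of x0])
    fix E T :: "ell2 \<Rightarrow> ell2"
    assume "linear E" "linear T" "\<And>z y. inner (E z) y = inner z (T y)"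
      "\<And>z. T (E z) = z" "T x0 = 0"
    then show thesis by (rule that)
  qed
  interpret hard_instance x0 E T \<mu> L q \<beta> p
  proof (rule hard_instance.intro)
    show "0 < \<mu>" "\<mu> \<le> L" using asm by auto
  qed (fact ET ratio q_eq size tuned)+
  obtain s where s: "\<And>k. s k = comm_rounds (M (hard_problem s)) k"
    using adapted_schedule[of M] asm unfolding tuned(3) by blast
  have in_class: "hard_problem s \<in> problem_class \<chi> L \<mu>"
    using hard_problem_in_class[of s] tuned by simp
  then have run: "first_order_run x0 (hard_problem s) (M (hard_problem s))"
    using asm unfolding decentralized_method_def by blast
  show "\<exists>P\<in>problem_class \<chi> L \<mu>. \<exists>xs::ell2.
         is_arg_min (average_fun P) (\<lambda>_. True) xs \<and>
         (\<forall>(\<epsilon>::real) (k::nat).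
            0 < \<epsilon> \<and> \<epsilon> < exp (- 6) \<and>
            (norm (output_at (M P) k - xs))\<^sup>2 \<le> \<epsilon> * (norm (x0 - xs))\<^sup>2 \<longrightarrow>
            1 / 96 * \<chi> * sqrt (L / \<mu>) * ln (1 / \<epsilon>) \<le> real (comm_rounds (M P) k))"
  proof (intro bexI[OF _ in_class] exI[of _ minimizer] conjI allI impI minimizer)
    fix \<epsilon> :: real and k :: nat
    let ?r = "comm_rounds (M (hard_problem s)) k" and ?D = "(norm (x0 - minimizer))\<^sup>2"
    assume \<epsilon>: "0 < \<epsilon> \<and> \<epsilon> < exp (- 6) \<and>
      (norm (output_at (M (hard_problem s)) k - minimizer))\<^sup>2 \<le> \<epsilon> * ?D"
    then have "q ^ (2 * (?r div p + 1)) * ?D \<le> \<epsilon> * ?D"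
      using output_error[OF run s, of k] by linarith
    moreover have "0 < ?D" using minimizer_neq by simp
    ultimately have "q ^ (2 * (?r div p + 1)) \<le> \<epsilon>" by (rule mult_right_le_imp_le)
    moreover have "16 < L / \<mu>" using asm by (simp add: field_simps)
    moreover have "ln (1 / q) \<le> 6 / sqrt (L / \<mu>)" using ratio(4) \<delta>_le by simp
    ultimately show "1 / 96 * \<chi> * sqrt (L / \<mu>) * ln (1 / \<epsilon>) \<le> real ?r"
      using asm size(2) ratio(1,2) \<epsilon> by (intro round_count_bound[where p = p and q = q]) auto
  qed
qed

end
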